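(* Let $\Phi^\star=(\phi_{\nu_k},\phi_{b_k},\lambda_{g_i})\in E$ be a maximizer of the dual problem $\sup_{\Phi\in E}-\mathcal{F}^\star(-\Phi)-\mathcal{G}^\star(\Delta\Phi)$ and let $\mathbb{P}^{h,\star}$ be the corresponding optimal solution of the primal problem $\min_{\mathbb{P}}\mathcal{F}(\Delta^\dagger\mathbb{P})+\mathcal{G}(\mathbb{P})$, a probability measure with $\frac{d\mathbb{P}^{h,\star}}{d\overline{\mathbb{P}}^h}=\exp(\Delta\Phi^\star/h)$. Then: (1) For every $0\le i\le N_T-1$, the joint law of $(X_i,X_{i+1})$ under $\mathbb{P}^{h,\star}$ has density $$\mathbb{P}^{h,\star}_{i,i+1}(x_i,x_{i+1})=\exp\Big(\psi^u_i(x_i)+\phi_{\nu_i}(x_i)+\tfrac1h\Lambda_i\cdot G^{(i)}(x_i)+\tfrac1h\Delta_{i,i+1}(x_i,x_{i+1})+\tfrac1h\Lambda_{i+1}\cdot G^{(i+1)}(x_{i+1})+\phi_{\nu_{i+1}}(x_{i+1})+\psi^d_{i+1}(x_{i+1})\Big)\,\overline{\mathbb{P}}^h_{i,i+1}(x_i,x_{i+1}),$$ and $\mathbb{P}^{h,\star}$ is Markovian. (2) For every $0\le k\le N_T$, the marginal law of $X_k$ under $\mathbb{P}^{h,\star}$ has density $$\nu_k^\star(x_k)=\mathbb{P}^{h,\star}_k(x_k)=\exp\Big(\psi^u_k(x_k)+\phi_{\nu_k}(x_k)+\tfrac1h\Lambda_k\cdot G^{(k)}(x_k)+\psi^d_k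(x_k)\Big).$$
   Context: Let $N_T,N_C,K\ge1$ be integers, $h>0$ the time step, $\mathcal{X}_k$ ($0\le k\le N_T$) the space of values at time step $k$ (e.g. $\mathbb{R}$), and $\Omega^h=\prod_{k=0}^{N_T}\mathcal{X}_k$ with canonical process $(X_k)$. The reference measure $\overline{\mathbb{P}}^h$ on $\Omega^h$ is the law of the Euler–Maruyama Markov chain $Y_{k+1}=Y_k+\overline\mu(Y_k,kh)h+\overline\sigma(Y_k,kh)h^{1/2}Z_k$, with $Z_k$ i.i.d. standard normal and $Y_0\sim\rho_0$. Measures are identified with their densities: $\rho_0$ also denotes the initial density, and $\overline{\mathbb{P}}^h_{k,k+1}(x_k,x_{k+1})$ denotes the transition density of $\overline{\mathbb{P}}^h$ from $x_k$ to $x_{k+1}$, so that $\overline{\mathbb{P}}^h$ has density $\rho_0(x_0)\prod_{k=0}^{N_T-1}\overline{\mathbb{P}}^h_{k,k+1}(x_k,x_{k+1})$. Let $B$ be an $\mathbb{R}^K$-valued function of two consecutive states, and for $i=1,\dots,N_C$ let $G_i$ be a real payoff function of the state at a grid time step $\tau_i\in\{0,\dots,N_T\}$; they are such that $\Delta$ below maps $E$ into $C_b(\Omega^h)$. For a finite nonnegative measure $\mathbb{P}$ on $\Omega^h$ put $\Delta^\dagger\mathbb{P}=(\nu_k,\nu_kb_k,g_i)$, where $\nu_k=X_k\#\mathbb{P}$, $(\nu_kb_k)(dx_k)=\frac1h\int B(x_k,x_{k+1})\mathbb{P}_{k,k+1}(dx_k,dx_{k+1})$ (integration in $x_{k+1}$,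 with $\mathbb{P}_{k,k+1}$ the joint law of $(X_k,X_{k+1})$), and $g_i=\int G_i(x_{\tau_i})d\mathbb{P}$. Let $E=\prod_{k=0}^{N_T}C_b(\mathcal{X}_k)\times\prod_{k=0}^{N_T-1}C_b(\mathcal{X}_k;\mathbb{R}^K)\times\mathbb{R}^{N_C}\ni\Phi=(\phi_{\nu_k},\phi_{b_k},\lambda_{g_i})$, paired with triples $(\nu,p,g)$ of finite signed measures $\nu_k$, $\mathbb{R}^K$-valued measures $p_k$ and reals $g_i$ by $\langle\Phi,(\nu,p,g)\rangle=h\sum_{k=0}^{N_T}\int\phi_{\nu_k}d\nu_k+h\sum_{k=0}^{N_T-1}\int\phi_{b_k}\cdot dp_k+\sum_i\lambda_{g_i}g_i$. The adjoint of $\Delta^\dagger$ is $$\Delta\Phi(x)=\sum_{k=0}^{N_T}h\,\phi_{\nu_k}(x_k)+\sum_{k=0}^{N_T-1}B(x_k,x_{k+1})\cdot\phi_{b_k}(x_k)+\sum_{i=1}^{N_C}\lambda_{g_i}G_i(x_{\tau_i}).$$ $\mathcal{G}(\mathbb{P})=h\,\mathrm{KL}(\mathbb{P}|\overline{\mathbb{P}}^h)$ with $\mathrm{KL}(\mathbb{P}|\overline{\mathbb{P}}^h)=\int(\log\frac{d\mathbb{P}}{d\overline{\mathbb{P}}^h}-1)d\mathbb{P}$ ($+\infty$ if $\mathbb{P}\not\ll\overline{\mathbb{P}}^h$), and $\mathcal{G}^\star(f)=h\,\mathbb{E}_{\overline{\mathbb{P}}^h}[e^{f/h}]$; the primal minimization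 is over finite nonnegative measures on $\Omega^h$. $\mathcal{F}(\nu,p,g)=\sum_{k=0}^{N_T-1}\mathcal{F}_{\mathrm{mom},k}(\nu_k,p_k)+\sum_{k=0}^{N_T}M_k(\nu_k)+\sum_{i=1}^{N_C}C_i(g_i)$ with all terms convex lower semicontinuous with values in $\mathbb{R}\cup\{+\infty\}$, $\mathcal{F}$ proper, and $\mathcal{F}^\star(\Phi)=\sup_{(\nu,p,g)}\langle\Phi,(\nu,p,g)\rangle-\mathcal{F}(\nu,p,g)$. Notation attached to $\Phi^\star$: $\mathcal{I}_k=\{i:\tau_i=k\}$, $\Lambda_k=(\lambda_{g_i})_{i\in\mathcal{I}_k}$, $G^{(k)}=(G_i)_{i\in\mathcal{I}_k}$, with $\Lambda_k\cdot G^{(k)}=\sum_{i\in\mathcal{I}_k}\lambda_{g_i}G_i$ (zero if $\mathcal{I}_k=\emptyset$), and $\Delta_{k,k+1}(x_k,x_{k+1})=B(x_k,x_{k+1})\cdot\phi_{b_k}(x_k)$. The forward and backward potentials are $$\psi^u_i(x_i)=\log\int\rho_0(x_0)\prod_{k=0}^{i-1}\exp\Big(\tfrac1h\Delta_{k,k+1}+\phi_{\nu_k}(x_k)+\tfrac1h\Lambda_k\cdot G^{(k)}(x_k)\Big)\overline{\mathbb{P}}^h_{k,k+1}\,dx_0\cdots dx_{i-1},$$ $$\psi^d_i(x_i)=\log\int\prod_{k=i}^{N_T-1}\exp\Big(\tfrac1h\Delta_{k,k+1}+\phi_{\nu_{k+1}}(x_{k+1})+\tfrac1h\Lambda_{k+1}\cdot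 G^{(k+1)}(x_{k+1})\Big)\overline{\mathbb{P}}^h_{k,k+1}\,dx_{i+1}\cdots dx_{N_T},$$ with $\psi^u_0=\log\rho_0$ and $\psi^d_{N_T}=0$. *)

theory Defs
  imports "HOL-Probability.Probability"
begin

section \<open>The Euler--Maruyama reference measure\<close>

text \<open>Each space of values is a Euclidean space \<open>'a\<close> (for instance \<open>real\<close>), and the noise lives in a
  Euclidean space \<open>'z\<close>; the diffusion coefficient \<open>\<sigma> x t\<close> is a linear map from \<open>'z\<close> to \<open>'a\<close>, which
  for \<open>'a = 'z = real\<close> is multiplication by a scalar.  Paths are extensional functions on \<open>{..NT}\<close>.\<close>

abbreviation path_space :: "nat \<Rightarrow> (nat \<Rightarrow> 'a::euclidean_space) measure" where
  "path_space NT \<equiv> Pi\<^sub>M {..NT} (\<lambda>_. borel)"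

definition std_gaussian :: "'z::euclidean_space measure" where
  "std_gaussian = density lborel (\<lambda>z. ennreal (\<Prod>b\<in>Basis. std_normal_density (z \<bullet> b)))"

definition em_step :: "real \<Rightarrow> ('a \<Rightarrow> real \<Rightarrow> 'a) \<Rightarrow> ('a \<Rightarrow> real \<Rightarrow> 'z \<Rightarrow> 'a) \<Rightarrow> nat
    \<Rightarrow> 'a \<Rightarrow> 'z \<Rightarrow> 'a::euclidean_space" where
  "em_step h \<mu> \<sigma> k y z = y + h *\<^sub>R \<mu> y (real k * h) + sqrt h *\<^sub>R \<sigma> y (real k * h) z"

primrec em_chain :: "real \<Rightarrow> ('a \<Rightarrow> real \<Rightarrow> 'a) \<Rightarrow> ('a \<Rightarrow> real \<Rightarrow> 'z \<Rightarrow> 'a)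
    \<Rightarrow> 'a \<Rightarrow> (nat \<Rightarrow> 'z) \<Rightarrow> nat \<Rightarrow> 'a::euclidean_space" where
  "em_chain h \<mu> \<sigma> y z 0 = y"
| "em_chain h \<mu> \<sigma> y z (Suc k) = em_step h \<mu> \<sigma> k (em_chain h \<mu> \<sigma> y z k) (z k)"

text \<open>The law of the chain; the product measure says that the initial value and the
  standard normal increments are independent.\<close>

definition em_law :: "nat \<Rightarrow> real \<Rightarrow> ('a \<Rightarrow> real \<Rightarrow> 'a) \<Rightarrow> ('a \<Rightarrow> real \<Rightarrow> 'z::euclidean_space \<Rightarrow> 'a)
    \<Rightarrow> ('a \<Rightarrow> real) \<Rightarrow> (nat \<Rightarrow> 'a::euclidean_space) measure" where
  "em_law NT h \<mu> \<sigma> \<rho>\<^sub>0 =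
     distr (density lborel (\<lambda>x. ennreal (\<rho>\<^sub>0 x)) \<Otimes>\<^sub>M Pi\<^sub>M {..<NT} (\<lambda>_. std_gaussian)) (path_space NT)
       (\<lambda>(y, z). restrict (em_chain h \<mu> \<sigma> y z) {..NT})"

definition transition_density :: "nat \<Rightarrow> real \<Rightarrow> ('a \<Rightarrow> real \<Rightarrow> 'a)
    \<Rightarrow> ('a \<Rightarrow> real \<Rightarrow> 'z::euclidean_space \<Rightarrow> 'a) \<Rightarrow> (nat \<Rightarrow> 'a \<Rightarrow> 'a::euclidean_space \<Rightarrow> real) \<Rightarrow> bool" where
  "transition_density NT h \<mu> \<sigma> p \<longleftrightarrow>
     (\<forall>k<NT. (\<lambda>(x, y). p k x y) \<in> borel_measurable (borel \<Otimes>\<^sub>M borel)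
        \<and> (\<forall>x y. 0 \<le> p k x y)
        \<and> (\<forall>x. distributed std_gaussian lborel (em_step h \<mu> \<sigma> k x) (\<lambda>y. ennreal (p k x y))))"

section \<open>Finite signed and vector measures\<close>

text \<open>A finite signed (\<open>'b = real\<close>) or vector-valued Borel measure is a countably additive set
  function, normalised to vanish off the Borel sets so that equal measures are equal functions.\<close>

definition vector_measures :: "('a::topological_space set \<Rightarrow> 'b::real_normed_vector) set" where
  "vector_measures = {m. (\<forall>A. A \<notin> sets borel \<longrightarrow> m A = 0) \<and>
     (\<forall>A :: nat \<Rightarrow> 'a set. range A \<subseteq> sets borel \<longrightarrow> disjoint_family A \<longrightarrow>
        (\<lambda>n. m (A n)) sums m (\<Union>n. A n))}"

text \<open>The positive part of the Jordan decomposition; the negative part of \<open>m\<close> is the positive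
  part of \<open>-m\<close>.\<close>

definition positive_part :: "('a::topological_space set \<Rightarrow> real) \<Rightarrow> 'a measure" where
  "positive_part m = measure_of UNIV (sets borel)
     (\<lambda>A. ennreal (SUP S\<in>{S \<in> sets borel. S \<subseteq> A}. m S))"

definition signed_integral :: "('a::topological_space set \<Rightarrow> real) \<Rightarrow> ('a \<Rightarrow> real) \<Rightarrow> real" where
  "signed_integral m f =
     (\<integral>x. f x \<partial>positive_part m) - (\<integral>x. f x \<partial>positive_part (\<lambda>A. - m A))"

definition vector_integral :: "('a::topological_space set \<Rightarrow> real^'k) \<Rightarrow> ('a \<Rightarrow> real^'k) \<Rightarrow> real" where
  "vector_integral m f = (\<Sum>j\<in>UNIV. signed_integral (\<lambda>A. m A $ j) (\<lambda>x. f x $ j))"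

text \<open>The coarsest topologies making integration against each bounded continuous function continuous.\<close>

definition signed_topology :: "('a::topological_space set \<Rightarrow> real) topology" where
  "signed_topology = pullback_topology vector_measures
     (\<lambda>m (\<phi> :: 'a \<Rightarrow>\<^sub>C real). signed_integral m (apply_bcontfun \<phi>)) euclidean"

definition vector_topology :: "('a::topological_space set \<Rightarrow> real^'k) topology" where
  "vector_topology = pullback_topology vector_measures
     (\<lambda>m (\<phi> :: 'a \<Rightarrow>\<^sub>C (real^'k)). vector_integral m (apply_bcontfun \<phi>)) euclidean"

text \<open>Convex combinations of set functions are formed pointwise, since the function type carries no
  vector space instance; hence convexity takes the operation \<open>mix t x y = t x + (1 - t) y\<close>
  as a parameter.\<close>

definition mix :: "real \<Rightarrow> 'b \<Rightarrow> 'b \<Rightarrow> 'b::real_vector" where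
  "mix t x y = t *\<^sub>R x + (1 - t) *\<^sub>R y"

definition mix_measure :: "real \<Rightarrow> ('s \<Rightarrow> 'b) \<Rightarrow> ('s \<Rightarrow> 'b) \<Rightarrow> 's \<Rightarrow> 'b::real_vector" where
  "mix_measure t m n = (\<lambda>A. mix t (m A) (n A))"

definition mix_pair :: "real \<Rightarrow> ('s \<Rightarrow> 'b) \<times> ('s \<Rightarrow> 'c) \<Rightarrow> ('s \<Rightarrow> 'b) \<times> ('s \<Rightarrow> 'c)
    \<Rightarrow> ('s \<Rightarrow> 'b::real_vector) \<times> ('s \<Rightarrow> 'c::real_vector)" where
  "mix_pair t a b = (mix_measure t (fst a) (fst b), mix_measure t (snd a) (snd b))"

definition convex_lsc :: "'v topology \<Rightarrow> (real \<Rightarrow> 'v \<Rightarrow> 'v \<Rightarrow> 'v) \<Rightarrow> ('v \<Rightarrow> ereal) \<Rightarrow> bool" where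
  "convex_lsc T comb f \<longleftrightarrow>
     (\<forall>x\<in>topspace T. f x \<noteq> -\<infinity>) \<and>
     (\<forall>x\<in>topspace T. \<forall>y\<in>topspace T. \<forall>t\<in>{0<..<1}.
        f (comb t x y) \<le> ereal t * f x + ereal (1 - t) * f y) \<and>
     (\<forall>c::real. closedin T {x \<in> topspace T. f x \<le> ereal c})"

section \<open>The primal and dual problems\<close>

text \<open>The space \<open>E\<close> and the space of moment triples.  In both, the families are indexed by all of
  \<open>nat\<close>, but only the components \<open>k \<le> NT\<close> (first) and \<open>k < NT\<close> (second) are ever used.\<close>

type_synonym ('a, 'k, 'c) potentials =
  "(nat \<Rightarrow> 'a \<Rightarrow>\<^sub>C real) \<times> (nat \<Rightarrow> 'a \<Rightarrow>\<^sub>C (real^'k)) \<times> (real^'c)"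

type_synonym ('a, 'k, 'c) moments =
  "(nat \<Rightarrow> 'a set \<Rightarrow> real) \<times> (nat \<Rightarrow> 'a set \<Rightarrow> real^'k) \<times> (real^'c)"

definition moment_space :: "nat \<Rightarrow> ('a::euclidean_space, 'k::finite, 'c) moments set" where
  "moment_space NT = {(\<nu>, q, g). (\<forall>k\<le>NT. \<nu> k \<in> vector_measures) \<and> (\<forall>k<NT. q k \<in> vector_measures)}"

definition pairing :: "nat \<Rightarrow> real \<Rightarrow> ('a::euclidean_space, 'k::finite, 'c::finite) potentials
    \<Rightarrow> ('a, 'k, 'c) moments \<Rightarrow> real" where
  "pairing NT h = (\<lambda>(\<phi>\<nu>, \<phi>b, lam) (\<nu>, q, g).
     h * (\<Sum>k\<le>NT. signed_integral (\<nu> k) (apply_bcontfun (\<phi>\<nu> k)))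
     + h * (\<Sum>k<NT. vector_integral (q k) (apply_bcontfun (\<phi>b k)))
     + (\<Sum>i\<in>UNIV. lam $ i * g $ i))"

definition potentials_uminus :: "('a::topological_space, 'k::finite, 'c::finite) potentials
    \<Rightarrow> ('a, 'k, 'c) potentials" where
  "potentials_uminus = (\<lambda>(\<phi>\<nu>, \<phi>b, lam). (\<lambda>k. - \<phi>\<nu> k, \<lambda>k. - \<phi>b k, - lam))"

definition Delta :: "nat \<Rightarrow> real \<Rightarrow> ('a::euclidean_space \<Rightarrow> 'a \<Rightarrow> real^'k::finite)
    \<Rightarrow> ('c::finite \<Rightarrow> 'a \<Rightarrow> real) \<Rightarrow> ('c \<Rightarrow> nat) \<Rightarrow> ('a, 'k, 'c) potentials \<Rightarrow> (nat \<Rightarrow> 'a) \<Rightarrow> real" where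
  "Delta NT h B G \<tau> = (\<lambda>(\<phi>\<nu>, \<phi>b, lam) x.
     (\<Sum>k\<le>NT. h * apply_bcontfun (\<phi>\<nu> k) (x k))
     + (\<Sum>k<NT. B (x k) (x (Suc k)) \<bullet> apply_bcontfun (\<phi>b k) (x k))
     + (\<Sum>i\<in>UNIV. lam $ i * G i (x (\<tau> i))))"

definition bounded_continuous_paths :: "nat \<Rightarrow> ((nat \<Rightarrow> 'a::euclidean_space) \<Rightarrow> real) set" where
  "bounded_continuous_paths NT = {f.
     continuous_map (product_topology (\<lambda>_. euclidean) {..NT}) euclideanreal f
     \<and> bounded (f ` (\<Pi>\<^sub>E k\<in>{..NT}. UNIV))}"

definition Delta_dagger :: "real \<Rightarrow> ('a::euclidean_space \<Rightarrow> 'a \<Rightarrow> real^'k::finite)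
    \<Rightarrow> ('c::finite \<Rightarrow> 'a \<Rightarrow> real) \<Rightarrow> ('c \<Rightarrow> nat) \<Rightarrow> (nat \<Rightarrow> 'a) measure \<Rightarrow> ('a, 'k, 'c) moments" where
  "Delta_dagger h B G \<tau> P =
     (\<lambda>k. measure (distr P borel (\<lambda>x. x k)),
      \<lambda>k A. if A \<in> sets borel
        then (1 / h) *\<^sub>R (\<integral>(x, y). indicator A x *\<^sub>R B x y
               \<partial>distr P (borel \<Otimes>\<^sub>M borel) (\<lambda>x. (x k, x (Suc k))))
        else 0,
      \<chi> i. \<integral>x. G i (x (\<tau> i)) \<partial>P)"

text \<open>The integral is split into its positive and negative parts because a Bochner integral would
  be \<open>0\<close> where the relative entropy is \<open>\<infinity>\<close>; the negative part is finite for finite \<open>R\<close>.\<close>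

definition KL :: "'s measure \<Rightarrow> 's measure \<Rightarrow> ereal" where
  "KL P R = (if absolutely_continuous R P then
       enn2ereal (\<integral>\<^sup>+x. ennreal (ln (enn2real (RN_deriv R P x)) - 1) \<partial>P)
       - enn2ereal (\<integral>\<^sup>+x. ennreal (1 - ln (enn2real (RN_deriv R P x))) \<partial>P)
     else \<infinity>)"

definition finite_path_measures :: "nat \<Rightarrow> (nat \<Rightarrow> 'a::euclidean_space) measure set" where
  "finite_path_measures NT = {P. finite_measure P \<and> sets P = sets (path_space NT)}"

definition F_total :: "nat \<Rightarrow> (nat \<Rightarrow> ('a set \<Rightarrow> real) \<times> ('a set \<Rightarrow> real^'k::finite) \<Rightarrow> ereal)
    \<Rightarrow> (nat \<Rightarrow> ('a set \<Rightarrow> real) \<Rightarrow> ereal) \<Rightarrow> ('c::finite \<Rightarrow> real \<Rightarrow> ereal)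
    \<Rightarrow> ('a, 'k, 'c) moments \<Rightarrow> ereal" where
  "F_total NT Fmom Mf Cf = (\<lambda>(\<nu>, q, g).
     (\<Sum>k<NT. Fmom k (\<nu> k, q k)) + (\<Sum>k\<le>NT. Mf k (\<nu> k)) + (\<Sum>i\<in>UNIV. Cf i (g $ i)))"

definition F_conjugate :: "nat \<Rightarrow> real
    \<Rightarrow> (('a::euclidean_space, 'k::finite, 'c::finite) moments \<Rightarrow> ereal)
    \<Rightarrow> ('a, 'k, 'c) potentials \<Rightarrow> ereal" where
  "F_conjugate NT h F \<Phi> = (SUP m\<in>moment_space NT. ereal (pairing NT h \<Phi> m) - F m)"

definition G_functional :: "real \<Rightarrow> 's measure \<Rightarrow> 's measure \<Rightarrow> ereal" where
  "G_functional h R P = ereal h * KL P R"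

definition G_conjugate :: "real \<Rightarrow> 's measure \<Rightarrow> ('s \<Rightarrow> real) \<Rightarrow> real" where
  "G_conjugate h R f = h * (\<integral>x. exp (f x / h) \<partial>R)"

definition dual_objective :: "nat \<Rightarrow> real \<Rightarrow> ('a::euclidean_space \<Rightarrow> 'a \<Rightarrow> real^'k::finite)
    \<Rightarrow> ('c::finite \<Rightarrow> 'a \<Rightarrow> real) \<Rightarrow> ('c \<Rightarrow> nat) \<Rightarrow> (nat \<Rightarrow> 'a) measure
    \<Rightarrow> (('a, 'k, 'c) moments \<Rightarrow> ereal) \<Rightarrow> ('a, 'k, 'c) potentials \<Rightarrow> ereal" where
  "dual_objective NT h B G \<tau> R F \<Phi> =
     - F_conjugate NT h F (potentials_uminus \<Phi>) - ereal (G_conjugate h R (Delta NT h B G \<tau> \<Phi>))"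

definition primal_objective :: "real \<Rightarrow> ('a::euclidean_space \<Rightarrow> 'a \<Rightarrow> real^'k::finite)
    \<Rightarrow> ('c::finite \<Rightarrow> 'a \<Rightarrow> real) \<Rightarrow> ('c \<Rightarrow> nat) \<Rightarrow> (nat \<Rightarrow> 'a) measure
    \<Rightarrow> (('a, 'k, 'c) moments \<Rightarrow> ereal) \<Rightarrow> (nat \<Rightarrow> 'a) measure \<Rightarrow> ereal" where
  "primal_objective h B G \<tau> R F P = F (Delta_dagger h B G \<tau> P) + G_functional h R P"

section \<open>Potentials and the Markov property\<close>

text \<open>Logarithm and exponential with the conventions \<open>log 0 = -\<infinity>\<close>, \<open>log \<infinity> = \<infinity>\<close>: the potential
  \<open>\<psi>\<^sup>u\<close> is \<open>-\<infinity>\<close> where its defining integral vanishes (e.g. where \<open>\<rho>\<^sub>0 = 0\<close>) and \<open>\<infinity>\<close> where it diverges.\<close>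

definition log_ennreal :: "ennreal \<Rightarrow> ereal" where
  "log_ennreal x = (if x = 0 then -\<infinity> else if x = \<infinity> then \<infinity> else ereal (ln (enn2real x)))"

definition exp_ereal :: "ereal \<Rightarrow> ennreal" where
  "exp_ereal a = (if a = -\<infinity> then 0 else if a = \<infinity> then \<infinity> else ennreal (exp (real_of_ereal a)))"

text \<open>\<open>Lambda_G G \<tau> lam k x\<close> is the sum of \<open>\<lambda>\<^sub>i G\<^sub>i(x)\<close> over the instruments \<open>i\<close> expiring at step \<open>k\<close>.\<close>

definition Lambda_G :: "('c::finite \<Rightarrow> 'a \<Rightarrow> real) \<Rightarrow> ('c \<Rightarrow> nat) \<Rightarrow> real^'c \<Rightarrow> nat \<Rightarrow> 'a \<Rightarrow> real" where
  "Lambda_G G \<tau> lam k x = (\<Sum>i\<in>{i. \<tau> i = k}. lam $ i * G i x)"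

definition Delta_step :: "('a \<Rightarrow> 'a \<Rightarrow> real^'k::finite) \<Rightarrow> (nat \<Rightarrow> 'a \<Rightarrow>\<^sub>C (real^'k))
    \<Rightarrow> nat \<Rightarrow> 'a::topological_space \<Rightarrow> 'a \<Rightarrow> real" where
  "Delta_step B \<phi>b k x y = B x y \<bullet> apply_bcontfun (\<phi>b k) x"

text \<open>In both potentials \<open>x\<close> runs over the integrated coordinates, and \<open>x(i := xi)\<close> inserts the
  free one.  For \<open>i = 0\<close>, resp. \<open>i = NT\<close>, the index set is empty, no integration takes place, and
  the values are \<open>log \<rho>\<^sub>0\<close>, resp. \<open>0\<close>.\<close>

definition psi_u :: "real \<Rightarrow> ('a::euclidean_space \<Rightarrow> 'a \<Rightarrow> real^'k::finite)
    \<Rightarrow> ('c::finite \<Rightarrow> 'a \<Rightarrow> real) \<Rightarrow> ('c \<Rightarrow> nat) \<Rightarrow> ('a \<Rightarrow> real) \<Rightarrow> (nat \<Rightarrow> 'a \<Rightarrow> 'a \<Rightarrow> real)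
    \<Rightarrow> ('a, 'k, 'c) potentials \<Rightarrow> nat \<Rightarrow> 'a \<Rightarrow> ereal" where
  "psi_u h B G \<tau> \<rho>\<^sub>0 p = (\<lambda>(\<phi>\<nu>, \<phi>b, lam) i xi.
     log_ennreal (\<integral>\<^sup>+x. (let y = x(i := xi) in
       ennreal (\<rho>\<^sub>0 (y 0) *
         (\<Prod>k<i. exp (Delta_step B \<phi>b k (y k) (y (Suc k)) / h + apply_bcontfun (\<phi>\<nu> k) (y k)
                     + Lambda_G G \<tau> lam k (y k) / h) * p k (y k) (y (Suc k)))))
       \<partial>Pi\<^sub>M {..<i} (\<lambda>_. lborel)))"

definition psi_d :: "nat \<Rightarrow> real \<Rightarrow> ('a::euclidean_space \<Rightarrow> 'a \<Rightarrow> real^'k::finite)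
    \<Rightarrow> ('c::finite \<Rightarrow> 'a \<Rightarrow> real) \<Rightarrow> ('c \<Rightarrow> nat) \<Rightarrow> (nat \<Rightarrow> 'a \<Rightarrow> 'a \<Rightarrow> real)
    \<Rightarrow> ('a, 'k, 'c) potentials \<Rightarrow> nat \<Rightarrow> 'a \<Rightarrow> ereal" where
  "psi_d NT h B G \<tau> p = (\<lambda>(\<phi>\<nu>, \<phi>b, lam) i xi.
     log_ennreal (\<integral>\<^sup>+x. (let y = x(i := xi) in
       ennreal (\<Prod>k\<in>{i..<NT}.
         exp (Delta_step B \<phi>b k (y k) (y (Suc k)) / h + apply_bcontfun (\<phi>\<nu> (Suc k)) (y (Suc k))
              + Lambda_G G \<tau> lam (Suc k) (y (Suc k)) / h) * p k (y k) (y (Suc k))))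
       \<partial>Pi\<^sub>M {i<..NT} (\<lambda>_. lborel)))"

text \<open>The canonical process is Markov: the conditional law of \<open>X\<^sub>k\<^sub>+\<^sub>1\<close> given \<open>X\<^sub>0, \<dots>, X\<^sub>k\<close> is that
  given \<open>X\<^sub>k\<close>.\<close>

definition markovian :: "nat \<Rightarrow> (nat \<Rightarrow> 'a::euclidean_space) measure \<Rightarrow> bool" where
  "markovian NT P \<longleftrightarrow> (\<forall>k<NT. \<forall>A\<in>sets borel. AE x in P.
     real_cond_exp P (vimage_algebra (space P) (\<lambda>x. restrict x {..k}) (path_space k))
       (\<lambda>x. indicator A (x (Suc k))) x
     = real_cond_exp P (vimage_algebra (space P) (\<lambda>x. x k) borel)
       (\<lambda>x. indicator A (x (Suc k))) x)"

end

theory Submission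
  imports Defs
begin

text \<open>
  The density of the optimal measure with respect to the reference chain is \<open>exp (\<Delta> / h)\<close>, and \<open>\<Delta>\<close> is
  a sum of terms depending on one state or on two consecutive states.  The reference chain itself has
  the product density \<open>\<rho>\<^sub>0(x\<^sub>0) \<Prod> p\<^sub>k(x\<^sub>k, x\<^sub>k\<^sub>+\<^sub>1)\<close> with respect to Lebesgue measure on path space
  (\<open>em_law_eq_density\<close>).  Hence the optimal measure again has a density of the form
  \<open>a(x\<^sub>0) \<Prod> \<kappa>\<^sub>k(x\<^sub>k, x\<^sub>k\<^sub>+\<^sub>1)\<close>, now with kernels that are in general not stochastic (\<open>chain_weight_reweighted\<close>).

  Such a density splits at every time \<open>k\<close> into a factor depending on the past and \<open>x\<^sub>k\<close> and a factor depending on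
  \<open>x\<^sub>k\<close> and the future.  Integrating out the future leaves a function of \<open>x\<^sub>k\<close>, the backward weight
  (\<open>marginal_initial_segment\<close>); integrating out the past leaves the forward weight.  The law of \<open>X\<^sub>k\<close> has their product
  as density, and the law of \<open>(X\<^sub>k, X\<^sub>k\<^sub>+\<^sub>1)\<close> has the kernel as an additional factor.  The conditional
  law of \<open>X\<^sub>k\<^sub>+\<^sub>1\<close> given the past is the kernel reweighted by the quotient of two backward weights, which involves
  the past through \<open>x\<^sub>k\<close> only (\<open>markovian_chain_weight\<close>).

  The potentials are the logarithms of these weights, the forward one up to the weight of the
  state \<open>x\<^sub>k\<close> itself.  The forward weight may vanish or be infinite, but the backward weight lies between two
  positive constants: \<open>\<Delta>\<close> is bounded for every choice of potentials, which bounds each of its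
  summands, and the untilted kernels have mass one (\<open>gibbs_kernel_integral_bounds\<close>,
  \<open>backward_weight_bounds\<close>).  The sum of potentials in the exponent is therefore
  never of the form \<open>-\<infinity> + \<infinity>\<close>, and its exponential is the product of the weights.
\<close>

section \<open>Recognising densities\<close>

lemma distributedI_nn_integral:
  assumes X: "X \<in> M \<rightarrow>\<^sub>M N" and f: "f \<in> borel_measurable N"
    and eq: "\<And>A. A \<in> sets N \<Longrightarrow> (\<integral>\<^sup>+x. indicator A (X x) \<partial>M) = (\<integral>\<^sup>+y. f y * indicator A y \<partial>N)"
  shows "distributed M N X f"
  unfolding distributed_def
proof (intro conjI measure_eqI)
  fix A assume "A \<in> sets (distr M N X)"
  then have A: "A \<in> sets N" by simp
  have "emeasure (distr M N X) A = (\<integral>\<^sup>+y. indicator A y \<partial>distr M N X)"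
    using A by simp
  also have "\<dots> = (\<integral>\<^sup>+x. indicator A (X x) \<partial>M)"
    using A by (intro nn_integral_distr X) auto
  also have "\<dots> = emeasure (density N f) A"
    using A f by (simp add: eq emeasure_density)
  finally show "emeasure (distr M N X) A = emeasure (density N f) A" .
qed (use X f in auto)

section \<open>Lebesgue measure on path space\<close>

interpretation lborel_paths: product_sigma_finite "\<lambda>_::nat. lborel :: 'a::euclidean_space measure"
  by standard

abbreviation leb_paths :: "nat set \<Rightarrow> (nat \<Rightarrow> 'a::euclidean_space) measure" where
  "leb_paths I \<equiv> Pi\<^sub>M I (\<lambda>_. lborel)"

lemma sets_leb_paths [measurable_cong]:
  "sets (leb_paths I :: (nat \<Rightarrow> 'a::euclidean_space) measure) = sets (Pi\<^sub>M I (\<lambda>_. borel))"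
  by (intro sets_PiM_cong) auto

lemma leb_paths_coordinate [measurable (raw)]:
  assumes "j \<in> I"
  shows "(\<lambda>x. x j) \<in> borel_measurable (leb_paths I :: (nat \<Rightarrow> 'a::euclidean_space) measure)"
  using measurable_component_singleton[OF assms, of "\<lambda>_. lborel :: 'a measure"] by simp

lemma sigma_finite_leb_paths:
  "finite I \<Longrightarrow> sigma_finite_measure (leb_paths I :: (nat \<Rightarrow> 'a::euclidean_space) measure)"
  by (rule lborel_paths.sigma_finite)

section \<open>Forward and backward weights of a path density\<close>

text \<open>The path density of a chain whose kernels \<open>\<kappa>\<close> are not normalised: tilting a transition density by an
  exponential destroys its normalisation, and the backward weight below is what measures the defect.\<close>

definition chain_weight :: "('a \<Rightarrow> ennreal) \<Rightarrow> (nat \<Rightarrow> 'a \<Rightarrow> 'a \<Rightarrow> ennreal) \<Rightarrow> nat \<Rightarrow> (nat \<Rightarrow> 'a) \<Rightarrow> ennreal"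
  where "chain_weight a \<kappa> k x = a (x 0) * (\<Prod>j<k. \<kappa> j (x j) (x (Suc j)))"

text \<open>What remains of the path density when all coordinates before, respectively after, time \<open>k\<close>
  are integrated out.  The integration variable carries no \<open>k\<close>-th coordinate, so the update
  \<open>x(k := \<xi>)\<close> supplies it; this keeps the index sets those of the forward and backward potentials.\<close>

definition forward_weight :: "('a \<Rightarrow> ennreal) \<Rightarrow> (nat \<Rightarrow> 'a \<Rightarrow> 'a \<Rightarrow> ennreal) \<Rightarrow> nat
    \<Rightarrow> 'a::euclidean_space \<Rightarrow> ennreal"
  where "forward_weight a \<kappa> k \<xi> = (\<integral>\<^sup>+x. chain_weight a \<kappa> k (x(k := \<xi>)) \<partial>leb_paths {..<k})"

definition backward_weight :: "nat \<Rightarrow> (nat \<Rightarrow> 'a \<Rightarrow> 'a \<Rightarrow> ennreal) \<Rightarrow> nat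
    \<Rightarrow> 'a::euclidean_space \<Rightarrow> ennreal"
  where "backward_weight n \<kappa> k \<xi> =
    (\<integral>\<^sup>+x. (\<Prod>j\<in>{k..<n}. \<kappa> j ((x(k := \<xi>)) j) ((x(k := \<xi>)) (Suc j))) \<partial>leb_paths {k<..n})"

lemma chain_weight_cong:
  "(\<And>j. j \<le> k \<Longrightarrow> x j = y j) \<Longrightarrow> chain_weight a \<kappa> k x = chain_weight a \<kappa> k y"
  unfolding chain_weight_def by (auto intro!: arg_cong2[where f="(*)"] prod.cong)

lemma chain_weight_Suc:
  "chain_weight a \<kappa> (Suc k) x = chain_weight a \<kappa> k x * \<kappa> k (x k) (x (Suc k))"
  unfolding chain_weight_def by (simp add: mult.assoc)

locale chain_kernels =
  fixes n :: nat and a :: "'a::euclidean_space \<Rightarrow> ennreal" and \<kappa> :: "nat \<Rightarrow> 'a \<Rightarrow> 'a \<Rightarrow> ennreal"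
  assumes a_measurable [measurable]: "a \<in> borel_measurable borel"
    and \<kappa>_measurable: "\<And>k. k < n \<Longrightarrow> (\<lambda>(x, y). \<kappa> k x y) \<in> borel_measurable (borel \<Otimes>\<^sub>M borel)"
begin

lemma \<kappa>_compose [measurable (raw)]:
  assumes "k < n" "f \<in> borel_measurable M" "g \<in> borel_measurable M"
  shows "(\<lambda>x. \<kappa> k (f x) (g x)) \<in> borel_measurable M"
  using measurable_compose[OF measurable_Pair[OF assms(2,3)] \<kappa>_measurable[OF assms(1)]] by simp

lemma chain_weight_measurable:
  assumes "k \<le> n" "{..k} \<subseteq> I"
  shows "chain_weight a \<kappa> k \<in> borel_measurable (leb_paths I)"
proof -
  have c: "(\<lambda>x. x j) \<in> borel_measurable (leb_paths I)" if "j \<le> k" for j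
    using that assms by (auto intro: leb_paths_coordinate)
  show ?thesis
    unfolding chain_weight_def
    using assms by (intro borel_measurable_times_ennreal borel_measurable_prod_ennreal
        measurable_compose[OF c a_measurable] \<kappa>_compose c) auto
qed

lemma backward_weight_last: "backward_weight n \<kappa> n \<xi> = 1"
  by (simp add: backward_weight_def PiM_empty)

lemma backward_integrand_measurable:
  "(\<lambda>x. \<Prod>i\<in>{k..<n}. \<kappa> i ((x(k := \<xi>)) i) ((x(k := \<xi>)) (Suc i)))
    \<in> borel_measurable (leb_paths {k<..n})"
proof -
  have c: "(\<lambda>x. (x(k := \<xi>)) j) \<in> borel_measurable (leb_paths {k<..n})" if "k \<le> j" "j \<le> n" for j
    using that by (cases "j = k") (auto intro: leb_paths_coordinate)
  show ?thesis
    by (intro borel_measurable_prod_ennreal \<kappa>_compose c) auto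
qed

text \<open>The dynamic programming equation: only the factor \<open>\<kappa> k\<close> couples \<open>\<xi>\<close> to the integrated
  coordinates, and it does so through \<open>x\<^sub>k\<^sub>+\<^sub>1\<close> alone.  Measurability and bounds of the backward weight,
  and the normalisation of the transition probabilities, are read off from it.\<close>

lemma backward_weight_rec:
  assumes "k < n"
  shows "backward_weight n \<kappa> k \<xi> = (\<integral>\<^sup>+y. \<kappa> k \<xi> y * backward_weight n \<kappa> (Suc k) y \<partial>lborel)"
proof -
  have I: "{k<..n} = insert (Suc k) {Suc k<..n}"
    using assms by auto
  have J: "{k..<n} = insert k {Suc k..<n}"
    using assms by auto
  let ?f = "\<lambda>x. \<Prod>j\<in>{k..<n}. \<kappa> j ((x(k := \<xi>)) j) ((x(k := \<xi>)) (Suc j))"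
  let ?g = "\<lambda>y x. \<Prod>j\<in>{Suc k..<n}. \<kappa> j ((x(Suc k := y)) j) ((x(Suc k := y)) (Suc j))"
  have f: "?f \<in> borel_measurable (leb_paths (insert (Suc k) {Suc k<..n}))"
    using backward_integrand_measurable[of k \<xi>] I by simp
  have split: "?f (x(Suc k := y)) = \<kappa> k \<xi> y * ?g y x" for x y
    unfolding J by (subst prod.insert) (auto intro!: arg_cong2[where f="(*)"] prod.cong)
  have "backward_weight n \<kappa> k \<xi> = (\<integral>\<^sup>+y. \<integral>\<^sup>+x. ?f (x(Suc k := y)) \<partial>leb_paths {Suc k<..n} \<partial>lborel)"
    unfolding backward_weight_def I
    by (rule lborel_paths.product_nn_integral_insert_rev[OF _ _ f]) auto
  also have "\<dots> = (\<integral>\<^sup>+y. \<kappa> k \<xi> y * backward_weight n \<kappa> (Suc k) y \<partial>lborel)"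
    unfolding split backward_weight_def
    by (intro nn_integral_cong nn_integral_cmult backward_integrand_measurable)
  finally show ?thesis .
qed

lemma backward_weight_measurable:
  "k \<le> n \<Longrightarrow> backward_weight n \<kappa> k \<in> borel_measurable borel"
proof (induction k rule: inc_induct)
  case base
  show ?case by (simp add: backward_weight_last[abs_def])
next
  case (step k)
  note [measurable] = step.IH
  have eq: "backward_weight n \<kappa> k = (\<lambda>\<xi>. \<integral>\<^sup>+y. \<kappa> k \<xi> y * backward_weight n \<kappa> (Suc k) y \<partial>lborel)"
    using backward_weight_rec step.hyps by auto
  have [measurable]: "(\<lambda>x. \<kappa> k (fst x) (snd x)) \<in> borel_measurable (borel \<Otimes>\<^sub>M lborel)"
    using step.hyps by (intro \<kappa>_compose) auto
  show ?case
    unfolding eq using lborel.borel_measurable_nn_integral[of "\<lambda>\<xi> y. \<kappa> k \<xi> y * backward_weight n \<kappa> (Suc k) y" borel]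
    by (simp add: case_prod_beta')
qed

text \<open>Bounds on the total masses of the kernels multiply along the recursion.  They make the backward
  weight a legitimate denominator, and its logarithm finite.\<close>

lemma backward_weight_bounds:
  assumes bounds: "\<And>k. k < n \<Longrightarrow> \<exists>c C::real. 0 < c \<and>
      (\<forall>x. ennreal c \<le> (\<integral>\<^sup>+y. \<kappa> k x y \<partial>lborel) \<and> (\<integral>\<^sup>+y. \<kappa> k x y \<partial>lborel) \<le> ennreal C)"
    and "k \<le> n"
  shows "\<exists>c C::real. 0 < c \<and>
      (\<forall>x. ennreal c \<le> backward_weight n \<kappa> k x \<and> backward_weight n \<kappa> k x \<le> ennreal C)"
  using \<open>k \<le> n\<close>
proof (induction k rule: inc_induct)
  case base
  show ?case by (intro exI[of _ 1]) (simp add: backward_weight_last)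
next
  case (step k)
  obtain c C :: real where c: "0 < c" "\<And>x. ennreal c \<le> backward_weight n \<kappa> (Suc k) x"
    "\<And>x. backward_weight n \<kappa> (Suc k) x \<le> ennreal C"
    using step.IH by blast
  obtain d D :: real where d: "0 < d" "\<And>x. ennreal d \<le> (\<integral>\<^sup>+y. \<kappa> k x y \<partial>lborel)"
    "\<And>x. (\<integral>\<^sup>+y. \<kappa> k x y \<partial>lborel) \<le> ennreal D"
    using bounds[OF step.hyps(2)] by blast
  have m: "(\<lambda>y. \<kappa> k x y) \<in> borel_measurable lborel" for x
    using step.hyps by (intro \<kappa>_compose) auto
  have "ennreal (d * c) \<le> backward_weight n \<kappa> k x \<and> backward_weight n \<kappa> k x \<le> ennreal (max 0 D * max 0 C)" for x
  proof
    have "ennreal (d * c) = ennreal d * ennreal c"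
      using c d by (simp add: ennreal_mult)
    also have "\<dots> \<le> (\<integral>\<^sup>+y. \<kappa> k x y \<partial>lborel) * ennreal c"
      by (intro mult_right_mono d) auto
    also have "\<dots> = (\<integral>\<^sup>+y. \<kappa> k x y * ennreal c \<partial>lborel)"
      by (rule nn_integral_multc[symmetric, OF m])
    also have "\<dots> \<le> backward_weight n \<kappa> k x"
      unfolding backward_weight_rec[OF step.hyps(2)] by (intro nn_integral_mono mult_left_mono c) auto
    finally show "ennreal (d * c) \<le> backward_weight n \<kappa> k x" .
    have "backward_weight n \<kappa> k x \<le> (\<integral>\<^sup>+y. \<kappa> k x y * ennreal C \<partial>lborel)"
      unfolding backward_weight_rec[OF step.hyps(2)] by (intro nn_integral_mono mult_left_mono c) auto
    also have "\<dots> = (\<integral>\<^sup>+y. \<kappa> k x y \<partial>lborel) * ennreal C"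
      by (rule nn_integral_multc[OF m])
    also have "\<dots> \<le> ennreal D * ennreal C"
      by (intro mult_right_mono d) auto
    also have "\<dots> = ennreal (max 0 D * max 0 C)"
      by (subst ennreal_mult) (auto simp: ennreal_max_0)
    finally show "backward_weight n \<kappa> k x \<le> ennreal (max 0 D * max 0 C)" .
  qed
  then show ?case using c d by (intro exI[of _ "d * c"] exI) auto
qed

text \<open>The density factorises at time \<open>k\<close>: the factors with index below \<open>k\<close> see the coordinates up to \<open>k\<close>, the
  others those from \<open>k\<close> on.  By Fubini the future contributes a function of \<open>x k\<close> alone, which is
  the analytic content of the Markov property.\<close>

lemma marginal_initial_segment:
  assumes "k \<le> n" and F: "F \<in> borel_measurable (leb_paths {..k})"
  shows "(\<integral>\<^sup>+x. chain_weight a \<kappa> n x * F (restrict x {..k}) \<partial>leb_paths {..n}) =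
    (\<integral>\<^sup>+x. chain_weight a \<kappa> k x * F x * backward_weight n \<kappa> k (x k) \<partial>leb_paths {..k})"
proof -
  have I: "{..n} = {..k} \<union> {k<..n}"
    using assms(1) by auto
  have J: "{..<n} = {..<k} \<union> {k..<n}"
    using assms(1) by auto
  let ?g = "\<lambda>\<xi> x. \<Prod>j\<in>{k..<n}. \<kappa> j ((x(k := \<xi>)) j) ((x(k := \<xi>)) (Suc j))"
  let ?f = "\<lambda>x. chain_weight a \<kappa> n x * F (restrict x {..k})"
  have f: "?f \<in> borel_measurable (leb_paths ({..k} \<union> {k<..n}))"
    unfolding I[symmetric]
    using assms by (intro borel_measurable_times_ennreal chain_weight_measurable
        measurable_compose[OF measurable_restrict_subset F]) auto
  have split: "?f (merge {..k} {k<..n} (x, y)) = chain_weight a \<kappa> k x * F x * ?g (x k) y"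
    if "x \<in> space (leb_paths {..k})" for x y
  proof -
    let ?m = "merge {..k} {k<..n} (x, y)"
    have r: "restrict ?m {..k} = x"
      using that by (auto simp: space_PiM PiE_iff extensional_def merge_def fun_eq_iff)
    have l: "?m j = x j" if "j \<le> k" for j
      using that by (simp add: merge_def)
    have u: "?m j = (y(k := x k)) j" if "k \<le> j" "j \<le> n" for j
      using that by (simp add: merge_def)
    have "chain_weight a \<kappa> n ?m =
        chain_weight a \<kappa> k ?m * (\<Prod>j\<in>{k..<n}. \<kappa> j (?m j) (?m (Suc j)))"
      unfolding chain_weight_def J by (subst prod.union_disjoint) (auto simp: mult.assoc)
    also have "chain_weight a \<kappa> k ?m = chain_weight a \<kappa> k x"
      using l by (intro chain_weight_cong) auto
    also have "(\<Prod>j\<in>{k..<n}. \<kappa> j (?m j) (?m (Suc j))) = ?g (x k) y"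
    proof (intro prod.cong refl)
      fix j assume "j \<in> {k..<n}"
      then show "\<kappa> j (?m j) (?m (Suc j)) = \<kappa> j ((y(k := x k)) j) ((y(k := x k)) (Suc j))"
        using u[of j] u[of "Suc j"] by simp
    qed
    finally show ?thesis unfolding r by (simp add: ac_simps)
  qed
  have "integral\<^sup>N (leb_paths {..n}) ?f =
      (\<integral>\<^sup>+x. \<integral>\<^sup>+y. ?f (merge {..k} {k<..n} (x, y)) \<partial>leb_paths {k<..n} \<partial>leb_paths {..k})"
    unfolding I by (rule lborel_paths.product_nn_integral_fold[OF _ _ _ f]) auto
  also have "\<dots> = (\<integral>\<^sup>+x. chain_weight a \<kappa> k x * F x * backward_weight n \<kappa> k (x k) \<partial>leb_paths {..k})"
    unfolding backward_weight_def
    by (intro nn_integral_cong, subst split, assumption,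
        intro nn_integral_cmult backward_integrand_measurable)
  finally show ?thesis .
qed

lemma forward_integrand_measurable:
  assumes "k \<le> n"
  shows "(\<lambda>x. chain_weight a \<kappa> k (x(k := \<xi>))) \<in> borel_measurable (leb_paths {..<k})"
  by (rule measurable_compose[OF measurable_fun_upd[of "insert k {..<k}" "{..<k}" k "\<lambda>x. x" _ _ "\<lambda>_. \<xi>"]
      chain_weight_measurable[of k "insert k {..<k}"]]) (use assms in auto)

lemma marginal_final_coordinate:
  assumes "k \<le> n" and F: "F \<in> borel_measurable borel"
  shows "(\<integral>\<^sup>+x. chain_weight a \<kappa> k x * F (x k) \<partial>leb_paths {..k}) =
    (\<integral>\<^sup>+\<xi>. forward_weight a \<kappa> k \<xi> * F \<xi> \<partial>lborel)"
proof -
  have I: "{..k} = insert k {..<k}" by auto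
  let ?f = "\<lambda>x. chain_weight a \<kappa> k x * F (x k)"
  have f: "?f \<in> borel_measurable (leb_paths (insert k {..<k}))"
    using assms by (intro borel_measurable_times_ennreal chain_weight_measurable
        measurable_compose[OF leb_paths_coordinate F]) auto
  show ?thesis
    unfolding I forward_weight_def
    by (subst lborel_paths.product_nn_integral_insert_rev[OF _ _ f])
      (auto simp: forward_integrand_measurable[OF assms(1)] nn_integral_multc)
qed

lemma forward_weight_measurable:
  assumes "k \<le> n"
  shows "forward_weight a \<kappa> k \<in> borel_measurable borel"
proof -
  interpret sigma_finite_measure "leb_paths {..<k} :: (nat \<Rightarrow> 'a) measure"
    by (rule sigma_finite_leb_paths) simp
  have upd: "(\<lambda>z. (snd z)(k := fst z)) \<in> borel \<Otimes>\<^sub>M leb_paths {..<k} \<rightarrow>\<^sub>M leb_paths (insert k {..<k})"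
    by (rule measurable_fun_upd) auto
  have "(\<lambda>(\<xi>, x). chain_weight a \<kappa> k (x(k := \<xi>))) \<in> borel_measurable (borel \<Otimes>\<^sub>M leb_paths {..<k})"
    unfolding case_prod_beta'
    by (rule measurable_compose[OF upd chain_weight_measurable]) (use assms in auto)
  then show ?thesis
    unfolding forward_weight_def[abs_def] by (rule borel_measurable_nn_integral)
qed

lemma marginal_coordinate:
  assumes "k \<le> n" and F: "F \<in> borel_measurable borel"
  shows "(\<integral>\<^sup>+x. chain_weight a \<kappa> n x * F (x k) \<partial>leb_paths {..n}) =
    (\<integral>\<^sup>+\<xi>. forward_weight a \<kappa> k \<xi> * backward_weight n \<kappa> k \<xi> * F \<xi> \<partial>lborel)"
proof -
  have "(\<lambda>x. F (x k)) \<in> borel_measurable (leb_paths {..k})"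
    by (rule measurable_compose[OF leb_paths_coordinate F]) simp
  from marginal_initial_segment[OF assms(1) this]
  have "(\<integral>\<^sup>+x. chain_weight a \<kappa> n x * F (x k) \<partial>leb_paths {..n}) =
    (\<integral>\<^sup>+x. chain_weight a \<kappa> k x * (F (x k) * backward_weight n \<kappa> k (x k)) \<partial>leb_paths {..k})"
    by (simp add: mult.assoc)
  also have "\<dots> = (\<integral>\<^sup>+\<xi>. forward_weight a \<kappa> k \<xi> * (F \<xi> * backward_weight n \<kappa> k \<xi>) \<partial>lborel)"
    using F backward_weight_measurable[OF assms(1)] by (intro marginal_final_coordinate[OF assms(1)]) auto
  finally show ?thesis by (simp add: ac_simps)
qed

text \<open>The case \<open>k + 1\<close> of \<open>marginal_initial_segment\<close> with the integral over the last coordinate displayed.  A test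
  function of the whole past together with the next state is what conditional expectations require.\<close>

lemma marginal_next_coordinate:
  assumes "k < n" and F: "(\<lambda>(x, y). F x y) \<in> borel_measurable (leb_paths {..k} \<Otimes>\<^sub>M borel)"
  shows "(\<integral>\<^sup>+x. chain_weight a \<kappa> n x * F (restrict x {..k}) (x (Suc k)) \<partial>leb_paths {..n}) =
    (\<integral>\<^sup>+x. chain_weight a \<kappa> k x *
       (\<integral>\<^sup>+y. F x y * \<kappa> k (x k) y * backward_weight n \<kappa> (Suc k) y \<partial>lborel) \<partial>leb_paths {..k})"
proof -
  have I: "{..Suc k} = insert (Suc k) {..k}" by auto
  let ?F = "\<lambda>x. F (restrict x {..k}) (x (Suc k))"
  have F': "?F \<in> borel_measurable (leb_paths {..Suc k})"
  proof -
    have "(\<lambda>x. (restrict x {..k}, x (Suc k))) \<in> leb_paths {..Suc k} \<rightarrow>\<^sub>M leb_paths {..k} \<Otimes>\<^sub>M borel"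
      by (intro measurable_Pair measurable_restrict_subset leb_paths_coordinate) auto
    from measurable_compose[OF this F] show ?thesis by simp
  qed
  let ?f = "\<lambda>x. chain_weight a \<kappa> (Suc k) x * ?F x * backward_weight n \<kappa> (Suc k) (x (Suc k))"
  have f: "?f \<in> borel_measurable (leb_paths (insert (Suc k) {..k}))"
    unfolding I[symmetric] using assms
    by (intro borel_measurable_times_ennreal chain_weight_measurable F'
        measurable_compose[OF leb_paths_coordinate backward_weight_measurable]) auto
  have step: "?f (x(Suc k := y)) =
      chain_weight a \<kappa> k x * (F x y * \<kappa> k (x k) y * backward_weight n \<kappa> (Suc k) y)"
    if "x \<in> space (leb_paths {..k})" for x y
  proof -
    have r: "restrict (x(Suc k := y)) {..k} = x"
      using that by (auto simp: space_PiM PiE_iff extensional_def fun_eq_iff restrict_def)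
    have "chain_weight a \<kappa> k (x(Suc k := y)) = chain_weight a \<kappa> k x"
      by (intro chain_weight_cong) auto
    then show ?thesis unfolding r by (simp add: chain_weight_Suc ac_simps)
  qed
  have m: "(\<lambda>y. F x y * \<kappa> k (x k) y * backward_weight n \<kappa> (Suc k) y) \<in> borel_measurable lborel"
    if "x \<in> space (leb_paths {..k})" for x
    using measurable_compose[OF measurable_Pair1'[OF that, of borel] F] assms backward_weight_measurable
    by (intro borel_measurable_times_ennreal \<kappa>_compose) auto
  have "restrict (restrict x {..Suc k}) {..k} = restrict x {..k}" for x :: "nat \<Rightarrow> 'a"
    by (auto simp: fun_eq_iff)
  with marginal_initial_segment[OF Suc_leI[OF assms(1)] F']
  have "(\<integral>\<^sup>+x. chain_weight a \<kappa> n x * F (restrict x {..k}) (x (Suc k)) \<partial>leb_paths {..n}) =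
    (\<integral>\<^sup>+x. ?f x \<partial>leb_paths {..Suc k})"
    by simp
  also have "\<dots> = (\<integral>\<^sup>+x. \<integral>\<^sup>+y. ?f (x(Suc k := y)) \<partial>lborel \<partial>leb_paths {..k})"
    unfolding I by (rule lborel_paths.product_nn_integral_insert[OF _ _ f]) auto
  also have "\<dots> = (\<integral>\<^sup>+x. chain_weight a \<kappa> k x *
       (\<integral>\<^sup>+y. F x y * \<kappa> k (x k) y * backward_weight n \<kappa> (Suc k) y \<partial>lborel) \<partial>leb_paths {..k})"
    by (intro nn_integral_cong, subst step, assumption, subst nn_integral_cmult[OF m]) auto
  finally show ?thesis .
qed

lemma marginal_pair:
  assumes "k < n" and F: "(\<lambda>(x, y). F x y) \<in> borel_measurable (borel \<Otimes>\<^sub>M borel)"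
  shows "(\<integral>\<^sup>+x. chain_weight a \<kappa> n x * F (x k) (x (Suc k)) \<partial>leb_paths {..n}) =
    (\<integral>\<^sup>+x. \<integral>\<^sup>+y. forward_weight a \<kappa> k x * \<kappa> k x y * backward_weight n \<kappa> (Suc k) y * F x y
      \<partial>lborel \<partial>lborel)"
proof -
  have [measurable]: "(\<lambda>x. x k) \<in> borel_measurable (leb_paths {..k})"
    by (rule leb_paths_coordinate) simp
  note [measurable] = F backward_weight_measurable[OF Suc_leI[OF assms(1)]]
  let ?K = "\<lambda>x y. F x y * \<kappa> k x y * backward_weight n \<kappa> (Suc k) y"
  have F': "(\<lambda>(x, y). F (x k) y) \<in> borel_measurable (leb_paths {..k} \<Otimes>\<^sub>M borel)"
    by measurable
  have "(\<lambda>z. \<kappa> k (fst z) (snd z)) \<in> borel_measurable (borel \<Otimes>\<^sub>M lborel)"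
    using assms by (intro \<kappa>_compose) auto
  then have K: "(\<lambda>(x, y). ?K x y) \<in> borel_measurable (borel \<Otimes>\<^sub>M lborel)"
    by (simp add: case_prod_beta')
  have K1: "?K x \<in> borel_measurable lborel" for x
    using measurable_compose[OF measurable_Pair1'[of x borel lborel] K] by simp
  have "(\<integral>\<^sup>+x. chain_weight a \<kappa> n x * F (x k) (x (Suc k)) \<partial>leb_paths {..n}) =
    (\<integral>\<^sup>+x. chain_weight a \<kappa> k x * (\<integral>\<^sup>+y. ?K (x k) y \<partial>lborel) \<partial>leb_paths {..k})"
    using marginal_next_coordinate[OF assms(1) F'] by simp
  also have "\<dots> = (\<integral>\<^sup>+x. forward_weight a \<kappa> k x * (\<integral>\<^sup>+y. ?K x y \<partial>lborel) \<partial>lborel)"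
    using assms(1) lborel.borel_measurable_nn_integral[OF K] by (intro marginal_final_coordinate) auto
  also have "\<dots> = (\<integral>\<^sup>+x. \<integral>\<^sup>+y. forward_weight a \<kappa> k x * ?K x y \<partial>lborel \<partial>lborel)"
    by (intro nn_integral_cong nn_integral_cmult[symmetric] K1)
  finally show ?thesis by (simp add: ac_simps)
qed

lemma nn_integral_chain_density:
  assumes "P = density (leb_paths {..n}) (chain_weight a \<kappa> n)" "f \<in> borel_measurable (leb_paths {..n})"
  shows "(\<integral>\<^sup>+x. f x \<partial>P) = (\<integral>\<^sup>+x. chain_weight a \<kappa> n x * f x \<partial>leb_paths {..n})"
  unfolding assms(1) using assms(2) by (intro nn_integral_density chain_weight_measurable) auto

section \<open>Laws of one and of two consecutive coordinates\<close>

lemma distributed_coordinate: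
  assumes P: "P = density (leb_paths {..n}) (chain_weight a \<kappa> n)" and k: "k \<le> n"
  shows "distributed P lborel (\<lambda>x. x k) (\<lambda>x. forward_weight a \<kappa> k x * backward_weight n \<kappa> k x)"
proof (rule distributedI_nn_integral)
  note [measurable] = forward_weight_measurable[OF k] backward_weight_measurable[OF k]
  have X: "(\<lambda>x. x k) \<in> leb_paths {..n} \<rightarrow>\<^sub>M lborel"
    using k by (auto intro: leb_paths_coordinate)
  then show "(\<lambda>x. x k) \<in> P \<rightarrow>\<^sub>M lborel"
    unfolding P by simp
  show "(\<lambda>x. forward_weight a \<kappa> k x * backward_weight n \<kappa> k x) \<in> borel_measurable lborel"
    by simp
  fix A :: "'a set" assume "A \<in> sets lborel"
  then show "(\<integral>\<^sup>+x. indicator A (x k) \<partial>P) =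
      (\<integral>\<^sup>+x. forward_weight a \<kappa> k x * backward_weight n \<kappa> k x * indicator A x \<partial>lborel)"
    using nn_integral_chain_density[OF P measurable_compose[OF X], of "indicator A"]
      marginal_coordinate[OF k, of "indicator A"] by simp
qed

lemma distributed_pair:
  assumes P: "P = density (leb_paths {..n}) (chain_weight a \<kappa> n)" and k: "k < n"
  shows "distributed P (lborel \<Otimes>\<^sub>M lborel) (\<lambda>x. (x k, x (Suc k)))
    (\<lambda>(x, y). forward_weight a \<kappa> k x * \<kappa> k x y * backward_weight n \<kappa> (Suc k) y)"
proof (rule distributedI_nn_integral)
  note [measurable] = forward_weight_measurable[OF less_imp_le[OF k]] backward_weight_measurable[OF Suc_leI[OF k]]
  have X: "(\<lambda>x. (x k, x (Suc k))) \<in> leb_paths {..n} \<rightarrow>\<^sub>M lborel \<Otimes>\<^sub>M lborel"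
    using k by (auto intro!: leb_paths_coordinate measurable_Pair)
  then show "(\<lambda>x. (x k, x (Suc k))) \<in> P \<rightarrow>\<^sub>M lborel \<Otimes>\<^sub>M lborel"
    unfolding P by simp
  have "(\<lambda>z. \<kappa> k (fst z) (snd z)) \<in> borel_measurable (lborel \<Otimes>\<^sub>M lborel)"
    using k by (intro \<kappa>_compose) auto
  then show f: "(\<lambda>(x, y). forward_weight a \<kappa> k x * \<kappa> k x y * backward_weight n \<kappa> (Suc k) y)
      \<in> borel_measurable (lborel \<Otimes>\<^sub>M lborel)"
    by (simp add: case_prod_beta')
  fix A :: "('a \<times> 'a) set" assume A: "A \<in> sets (lborel \<Otimes>\<^sub>M lborel)"
  then have A': "A \<in> sets (borel \<Otimes>\<^sub>M borel)"
    by (simp cong: sets_pair_measure_cong)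
  have "(\<integral>\<^sup>+x. indicator A (x k, x (Suc k)) \<partial>P) =
      (\<integral>\<^sup>+x. chain_weight a \<kappa> n x * indicator A (x k, x (Suc k)) \<partial>leb_paths {..n})"
    using nn_integral_chain_density[OF P measurable_compose[OF X], of "indicator A"] A by simp
  also have "\<dots> = (\<integral>\<^sup>+x. \<integral>\<^sup>+y. forward_weight a \<kappa> k x * \<kappa> k x y * backward_weight n \<kappa> (Suc k) y
      * indicator A (x, y) \<partial>lborel \<partial>lborel)"
    using marginal_pair[OF k, of "\<lambda>x y. indicator A (x, y)"] A' by simp
  also have "\<dots> = (\<integral>\<^sup>+z. (case z of (x, y) \<Rightarrow> forward_weight a \<kappa> k x * \<kappa> k x y *
      backward_weight n \<kappa> (Suc k) y) * indicator A z \<partial>(lborel \<Otimes>\<^sub>M lborel))"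
    using f A by (subst lborel.nn_integral_fst[symmetric]) auto
  finally show "(\<integral>\<^sup>+x. indicator A (x k, x (Suc k)) \<partial>P) = \<dots>" .
qed

section \<open>The Markov property\<close>

text \<open>The function \<open>m\<close> is the transition probability into \<open>A\<close> of the Doob transform of \<open>\<kappa> k\<close> by the backward weight.
  The recursion makes the numerator at most the denominator, whence a value in \<open>[0, 1]\<close>.\<close>

lemma transition_probability:
  assumes k: "k < n" and A: "A \<in> sets borel"
    and D: "\<And>x. 0 < backward_weight n \<kappa> k x \<and> backward_weight n \<kappa> k x < \<infinity>"
  obtains m where "m \<in> borel_measurable borel" "\<And>x. 0 \<le> m x" "\<And>x. m x \<le> (1::real)"
    "\<And>x. ennreal (m x) * backward_weight n \<kappa> k x =
      (\<integral>\<^sup>+y. indicator A y * (\<kappa> k x y * backward_weight n \<kappa> (Suc k) y) \<partial>lborel)"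
proof -
  let ?D = "backward_weight n \<kappa>"
  define N where "N x = (\<integral>\<^sup>+y. indicator A y * (\<kappa> k x y * ?D (Suc k) y) \<partial>lborel)" for x
  note [measurable] = A backward_weight_measurable[OF Suc_leI[OF k]]
    backward_weight_measurable[OF less_imp_le[OF k]]
  have "(\<lambda>z. \<kappa> k (fst z) (snd z)) \<in> borel_measurable (borel \<Otimes>\<^sub>M lborel)"
    using k by (intro \<kappa>_compose) auto
  then have "(\<lambda>(x, y). indicator A y * (\<kappa> k x y * ?D (Suc k) y)) \<in> borel_measurable (borel \<Otimes>\<^sub>M lborel)"
    by (simp add: case_prod_beta')
  from lborel.borel_measurable_nn_integral[OF this]
  have [measurable]: "N \<in> borel_measurable borel"
    unfolding N_def[abs_def] by simp
  have N_le: "N x \<le> ?D k x" for x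
    unfolding N_def backward_weight_rec[OF k]
    by (intro nn_integral_mono) (simp split: split_indicator)
  have quot: "N x / ?D k x \<le> 1" for x
    using D[of x] N_le[of x] by (simp add: divide_le_posI_ennreal)
  show thesis
  proof
    show "(\<lambda>x. enn2real (N x / ?D k x)) \<in> borel_measurable borel"
      by measurable
    show "enn2real (N x / ?D k x) \<le> 1" for x
      using enn2real_mono[OF quot] by simp
    show "ennreal (enn2real (N x / ?D k x)) * ?D k x =
      (\<integral>\<^sup>+y. indicator A y * (\<kappa> k x y * ?D (Suc k) y) \<partial>lborel)" for x
    proof -
      have "N x / ?D k x < \<infinity>"
        using quot[of x] by (simp add: order_le_less_trans)
      then show ?thesis
        unfolding N_def[symmetric] using D[of x]
        by (simp add: ennreal_divide_times less_imp_neq[THEN not_sym])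
    qed
  qed simp
qed

text \<open>Both conditional expectations in the definition have \<open>m (x k)\<close> as a version, with \<open>m\<close> the
  transition probability above.  It suffices to test against events of the past up to \<open>k\<close>, because every
  event of the present \<open>x k\<close> is one of them.\<close>

lemma markovian_chain_weight:
  assumes prob: "prob_space P"
    and P: "P = density (leb_paths {..n}) (chain_weight a \<kappa> n)"
    and D: "\<And>k x. k \<le> n \<Longrightarrow> 0 < backward_weight n \<kappa> k x \<and> backward_weight n \<kappa> k x < \<infinity>"
  shows "markovian n P"
  unfolding markovian_def
proof (intro allI impI ballI)
  fix k and A :: "'a set" assume k: "k < n" and A: "A \<in> sets borel"
  let ?D = "backward_weight n \<kappa>"
  interpret prob_space P by (rule prob)
  obtain m where m [measurable]: "m \<in> borel_measurable borel" and m_nonneg: "\<And>x. 0 \<le> m x"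
    and m_le: "\<And>x. m x \<le> 1" and m_eq: "\<And>x. ennreal (m x) * ?D k x =
      (\<integral>\<^sup>+y. indicator A y * (\<kappa> k x y * ?D (Suc k) y) \<partial>lborel)"
    using transition_probability[OF k A D[OF less_imp_le[OF k]]] by blast
  have sets_P [measurable_cong]: "sets P = sets (leb_paths {..n})" and space_P: "space P = space (leb_paths {..n})"
    unfolding P by simp_all
  have [measurable]: "(\<lambda>x. x (Suc k)) \<in> borel_measurable P" "(\<lambda>x. x k) \<in> borel_measurable P"
    using k by (auto simp: measurable_cong_sets[OF sets_P] intro!: leb_paths_coordinate)
  have restr [measurable]: "(\<lambda>x. restrict x {..k}) \<in> P \<rightarrow>\<^sub>M leb_paths {..k}"
    unfolding measurable_cong_sets[OF sets_P refl] using k by (intro measurable_restrict_subset) auto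
  note [measurable] = A backward_weight_measurable[OF Suc_leI[OF k]]
  have disintegration: "(\<integral>\<^sup>+x. f (restrict x {..k}) * indicator A (x (Suc k)) \<partial>P)
      = (\<integral>\<^sup>+x. f (restrict x {..k}) * ennreal (m (x k)) \<partial>P)"
    if f [measurable]: "f \<in> borel_measurable (leb_paths {..k})" for f
  proof -
    note [measurable] = leb_paths_coordinate[of k "{..k}", simplified]
    have dens: "(\<integral>\<^sup>+x. g x \<partial>P) = (\<integral>\<^sup>+x. chain_weight a \<kappa> n x * g x \<partial>leb_paths {..n})"
      if "g \<in> borel_measurable P" for g
      unfolding P using that by (intro nn_integral_density chain_weight_measurable)
        (auto simp: measurable_cong_sets[OF sets_P refl])
    have inner: "(\<lambda>y. indicator A y * (\<kappa> k x y * ?D (Suc k) y)) \<in> borel_measurable lborel" for x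
      using k by (intro borel_measurable_times_ennreal \<kappa>_compose) auto
    have "(\<integral>\<^sup>+x. f (restrict x {..k}) * indicator A (x (Suc k)) \<partial>P) =
        (\<integral>\<^sup>+x. chain_weight a \<kappa> n x * (f (restrict x {..k}) * indicator A (x (Suc k))) \<partial>leb_paths {..n})"
      by (rule dens) measurable
    also have "\<dots> = (\<integral>\<^sup>+x. chain_weight a \<kappa> k x *
       (\<integral>\<^sup>+y. f x * indicator A y * \<kappa> k (x k) y * ?D (Suc k) y \<partial>lborel) \<partial>leb_paths {..k})"
      by (rule marginal_next_coordinate[OF k]) measurable
    also have "\<dots> = (\<integral>\<^sup>+x. chain_weight a \<kappa> k x * (f x * ennreal (m (x k))) * ?D k (x k) \<partial>leb_paths {..k})"
      by (intro nn_integral_cong) (simp add: mult.assoc m_eq nn_integral_cmult[OF inner])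
    also have "\<dots> = (\<integral>\<^sup>+x. chain_weight a \<kappa> n x *
        (f (restrict x {..k}) * ennreal (m (restrict x {..k} k))) \<partial>leb_paths {..n})"
      using k by (intro marginal_initial_segment[symmetric]) auto
    also have "\<dots> = (\<integral>\<^sup>+x. f (restrict x {..k}) * ennreal (m (x k)) \<partial>P)"
      by (subst dens) auto
    finally show ?thesis .
  qed
  \<comment> \<open>One argument serves both sub-sigma-algebras: the past, and the present inside it.\<close>
  have cond_exp: "AE x in P. real_cond_exp P F (\<lambda>x. indicator A (x (Suc k))) x = m (x k)"
    if "space F = space P" and m_F: "(\<lambda>x. m (x k)) \<in> borel_measurable F"
      and sub: "\<And>S. S \<in> sets F \<Longrightarrow>
        \<exists>S'\<in>sets (leb_paths {..k}). S = (\<lambda>x. restrict x {..k}) -` S' \<inter> space P" for F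
  proof -
    have "sets F \<subseteq> sets P"
      using sub measurable_sets[OF restr] by blast
    then interpret finite_measure_subalgebra P F
      using that by unfold_locales (simp add: subalgebra_def)
    show ?thesis
    proof (rule real_cond_exp_charact)
      have bounded: "integrable P g" if "g \<in> borel_measurable P" "\<And>x. 0 \<le> g x" "\<And>x. g x \<le> 1"
        for g :: "_ \<Rightarrow> real"
        using that by (intro integrable_const_bound[of _ 1]) auto
      show "integrable P (\<lambda>x. indicator A (x (Suc k)) :: real)"
        by (rule bounded) (auto split: split_indicator)
      show "integrable P (\<lambda>x. m (x k))"
        by (rule bounded) (auto simp: m_nonneg m_le)
      fix S assume "S \<in> sets F"
      from sub[OF this] obtain S' where S' [measurable]: "S' \<in> sets (leb_paths {..k})"
        and S: "S = (\<lambda>x. restrict x {..k}) -` S' \<inter> space P" by blast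
      have eq: "set_lebesgue_integral P S g = enn2real (\<integral>\<^sup>+x. indicator S' (restrict x {..k}) * ennreal (g x) \<partial>P)"
        if [measurable]: "g \<in> borel_measurable P" and "\<And>x. 0 \<le> g x" for g
      proof -
        have "set_lebesgue_integral P S g = (\<integral>x. indicator S' (restrict x {..k}) * g x \<partial>P)"
          unfolding set_lebesgue_integral_def S
          by (intro Bochner_Integration.integral_cong) (auto split: split_indicator)
        also have "\<dots> = enn2real (\<integral>\<^sup>+x. ennreal (indicator S' (restrict x {..k}) * g x) \<partial>P)"
          using that by (intro integral_eq_nn_integral) auto
        also have "(\<integral>\<^sup>+x. ennreal (indicator S' (restrict x {..k}) * g x) \<partial>P) =
            (\<integral>\<^sup>+x. indicator S' (restrict x {..k}) * ennreal (g x) \<partial>P)"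
          by (intro nn_integral_cong) (auto split: split_indicator)
        finally show ?thesis .
      qed
      have "(\<integral>\<^sup>+x. indicator S' (restrict x {..k}) * ennreal (indicator A (x (Suc k))) \<partial>P)
          = (\<integral>\<^sup>+x. indicator S' (restrict x {..k}) * ennreal (m (x k)) \<partial>P)"
        using disintegration[of "indicator S'"] by (simp add: ennreal_indicator)
      then show "set_lebesgue_integral P S (\<lambda>x. indicator A (x (Suc k))) =
          set_lebesgue_integral P S (\<lambda>x. m (x k))"
        by (subst (1 2) eq) (auto simp: m_nonneg)
    qed (rule m_F)
  qed
  have restr_Pi: "(\<lambda>x. restrict x {..k}) \<in> space P \<rightarrow> space (path_space k)"
    by (auto simp: space_PiM)
  have "AE x in P. real_cond_exp P (vimage_algebra (space P) (\<lambda>x. restrict x {..k}) (path_space k))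
      (\<lambda>x. indicator A (x (Suc k))) x = m (x k)"
  proof (rule cond_exp)
    have "(\<lambda>x. m (restrict x {..k} k)) \<in>
        borel_measurable (vimage_algebra (space P) (\<lambda>x. restrict x {..k}) (path_space k))"
      by (rule measurable_compose[OF measurable_vimage_algebra1[OF restr_Pi]]) simp
    then show "(\<lambda>x. m (x k)) \<in>
        borel_measurable (vimage_algebra (space P) (\<lambda>x. restrict x {..k}) (path_space k))"
      by simp
  qed (auto simp: sets_vimage_algebra2[OF restr_Pi] sets_leb_paths)
  moreover have "AE x in P. real_cond_exp P (vimage_algebra (space P) (\<lambda>x. x k) borel)
      (\<lambda>x. indicator A (x (Suc k))) x = m (x k)"
  proof (rule cond_exp)
    show "(\<lambda>x. m (x k)) \<in> borel_measurable (vimage_algebra (space P) (\<lambda>x. x k) borel)"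
      by (rule measurable_compose[OF measurable_vimage_algebra1 m]) simp
    fix S assume "S \<in> sets (vimage_algebra (space P) (\<lambda>x. x k) borel)"
    then obtain T where T: "T \<in> sets borel" "S = (\<lambda>x. x k) -` T \<inter> space P"
      by (auto simp: sets_vimage_algebra2)
    have "(\<lambda>x. x k) -` T \<inter> space (leb_paths {..k}) \<in> sets (leb_paths {..k})"
      using measurable_sets[OF leb_paths_coordinate T(1), of k "{..k}"] by simp
    moreover have "S = (\<lambda>x. restrict x {..k}) -` ((\<lambda>x. x k) -` T \<inter> space (leb_paths {..k})) \<inter> space P"
      unfolding T(2) by (auto simp: space_PiM)
    ultimately show "\<exists>S'\<in>sets (leb_paths {..k}). S = (\<lambda>x. restrict x {..k}) -` S' \<inter> space P"
      by blast
  qed simp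
  ultimately show "AE x in P.
      real_cond_exp P (vimage_algebra (space P) (\<lambda>x. restrict x {..k}) (path_space k))
        (\<lambda>x. indicator A (x (Suc k))) x
      = real_cond_exp P (vimage_algebra (space P) (\<lambda>x. x k) borel)
        (\<lambda>x. indicator A (x (Suc k))) x"
    by eventually_elim simp
qed

end

section \<open>The density of the Euler--Maruyama chain\<close>

lemma prob_space_std_gaussian: "prob_space (std_gaussian :: 'z::euclidean_space measure)"
proof
  have "(\<integral>\<^sup>+z. ennreal (\<Prod>b\<in>Basis. std_normal_density ((z::'z) \<bullet> b)) \<partial>lborel) =
      (\<integral>\<^sup>+z. (\<Prod>b\<in>Basis. ennreal (std_normal_density ((z::'z) \<bullet> b))) \<partial>lborel)"
    by (simp add: prod_ennreal)
  also have "\<dots> = 1"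
    by (subst nn_integral_lborel_prod) (simp_all add: nn_integral_eq_integral)
  finally show "emeasure (std_gaussian :: 'z measure) (space std_gaussian) = 1"
    by (simp add: std_gaussian_def emeasure_density)
qed

lemma sets_std_gaussian [simp, measurable_cong]: "sets std_gaussian = sets borel"
  by (simp add: std_gaussian_def)

text \<open>Linearity of \<open>\<sigma> x t\<close> upgrades measurability in \<open>x\<close> for each fixed noise to joint measurability: in
  coordinates the step depends on the noise through finitely many scalars.\<close>

lemma em_step_measurable:
  fixes \<mu> :: "'a::euclidean_space \<Rightarrow> real \<Rightarrow> 'a" and \<sigma> :: "'a \<Rightarrow> real \<Rightarrow> 'z::euclidean_space \<Rightarrow> 'a"
  assumes [measurable]: "\<And>t. (\<lambda>x. \<mu> x t) \<in> borel_measurable borel"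
    "\<And>t z. (\<lambda>x. \<sigma> x t z) \<in> borel_measurable borel"
    and lin: "\<And>x t. linear (\<sigma> x t)"
  shows "(\<lambda>(y, z). em_step h \<mu> \<sigma> k y z) \<in> borel_measurable (borel \<Otimes>\<^sub>M borel)"
proof -
  have expand: "\<sigma> x t z = (\<Sum>b\<in>Basis. (z \<bullet> b) *\<^sub>R \<sigma> x t b)" for x t z
    by (subst euclidean_representation[of z, symmetric])
      (simp only: linear_sum[OF lin] linear_scale[OF lin])
  have "em_step h \<mu> \<sigma> k y z = y + h *\<^sub>R \<mu> y (real k * h)
      + sqrt h *\<^sub>R (\<Sum>b\<in>Basis. (z \<bullet> b) *\<^sub>R \<sigma> y (real k * h) b)" for y z
    unfolding em_step_def by (subst expand) (rule refl)
  then show ?thesis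
    by (simp add: case_prod_beta')
qed

lemma em_chain_cong: "(\<And>j. j < k \<Longrightarrow> z j = z' j) \<Longrightarrow> em_chain h \<mu> \<sigma> y z k = em_chain h \<mu> \<sigma> y z' k"
  by (induction k) auto

context
  fixes \<mu> :: "'a::euclidean_space \<Rightarrow> real \<Rightarrow> 'a" and \<sigma> :: "'a \<Rightarrow> real \<Rightarrow> 'z::euclidean_space \<Rightarrow> 'a"
    and \<rho> :: "'a \<Rightarrow> real" and h :: real
  assumes coeff: "\<And>t. (\<lambda>x. \<mu> x t) \<in> borel_measurable borel"
    "\<And>t z. (\<lambda>x. \<sigma> x t z) \<in> borel_measurable borel" "\<And>x t. linear (\<sigma> x t)"
    and \<rho> [measurable]: "\<rho> \<in> borel_measurable borel"
begin

abbreviation "noise k \<equiv> (Pi\<^sub>M {..<k} (\<lambda>_. std_gaussian) :: (nat \<Rightarrow> 'z) measure)"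
abbreviation "initial \<equiv> density lborel (\<lambda>x. ennreal (\<rho> x))"

lemma em_chain_measurable:
  assumes "k \<le> n"
  shows "(\<lambda>(y, z). em_chain h \<mu> \<sigma> y z k) \<in> borel_measurable (initial \<Otimes>\<^sub>M noise n)"
  using assms
proof (induction k)
  case 0
  show ?case by simp
next
  case (Suc k)
  then have [measurable]: "(\<lambda>z. em_chain h \<mu> \<sigma> (fst z) (snd z) k) \<in> borel_measurable (initial \<Otimes>\<^sub>M noise n)"
    by (simp add: case_prod_beta')
  have [measurable]: "(\<lambda>z. snd z k) \<in> borel_measurable (initial \<Otimes>\<^sub>M noise n)"
    using measurable_compose[OF measurable_snd measurable_component_singleton[of k "{..<n}" "\<lambda>_. std_gaussian :: 'z measure"],
        unfolded measurable_cong_sets[OF refl sets_std_gaussian]] Suc.prems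
    by simp
  have "(\<lambda>z. (em_chain h \<mu> \<sigma> (fst z) (snd z) k, snd z k)) \<in> initial \<Otimes>\<^sub>M noise n \<rightarrow>\<^sub>M borel \<Otimes>\<^sub>M borel"
    by measurable
  from measurable_compose[OF this em_step_measurable[OF coeff, where h=h and k=k]] show ?case
    by (simp add: case_prod_beta')
qed

lemma em_path_measurable:
  "(\<lambda>(y, z). restrict (em_chain h \<mu> \<sigma> y z) {..n}) \<in> initial \<Otimes>\<^sub>M noise n \<rightarrow>\<^sub>M path_space n"
proof (rule measurable_PiM_single')
  fix i assume "i \<in> {..n}"
  then show "(\<lambda>\<omega>. (case \<omega> of (y, z) \<Rightarrow> restrict (em_chain h \<mu> \<sigma> y z) {..n}) i)
      \<in> initial \<Otimes>\<^sub>M noise n \<rightarrow>\<^sub>M borel"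
    using em_chain_measurable[of i n] by (simp add: case_prod_beta')
qed (auto split: if_splits)

lemma nn_integral_em_law:
  assumes "f \<in> borel_measurable (leb_paths {..n})"
  shows "(\<integral>\<^sup>+x. f x \<partial>em_law n h \<mu> \<sigma> \<rho>) =
    (\<integral>\<^sup>+y. \<integral>\<^sup>+z. f (restrict (em_chain h \<mu> \<sigma> y z) {..n}) \<partial>noise n \<partial>initial)"
proof -
  interpret noise: prob_space "noise n"
    by (intro prob_space_PiM prob_space_std_gaussian)
  have f: "f \<in> borel_measurable (path_space n)"
    using assms by (simp add: measurable_cong_sets[OF sets_leb_paths refl])
  have "(\<integral>\<^sup>+x. f x \<partial>em_law n h \<mu> \<sigma> \<rho>) =
    (\<integral>\<^sup>+w. f (case w of (y, z) \<Rightarrow> restrict (em_chain h \<mu> \<sigma> y z) {..n}) \<partial>(initial \<Otimes>\<^sub>M noise n))"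
    unfolding em_law_def by (rule nn_integral_distr[OF em_path_measurable]) (simp add: f)
  also have "\<dots> = (\<integral>\<^sup>+y. \<integral>\<^sup>+z. f (restrict (em_chain h \<mu> \<sigma> y z) {..n}) \<partial>noise n \<partial>initial)"
    using noise.nn_integral_fst[OF measurable_compose[OF em_path_measurable f], symmetric] by simp
  finally show ?thesis .
qed

text \<open>Induction over the steps.  The last increment enters only the last state, so integrating it out first
  replaces that state by an integral against the transition density from its predecessor.  The test
  function has to be arbitrary, since this integral becomes the test function of the shorter chain.\<close>

lemma nn_integral_em_law_density:
  assumes p: "transition_density n h \<mu> \<sigma> p"
    and f: "f \<in> borel_measurable (leb_paths {..n})"
  shows "(\<integral>\<^sup>+x. f x \<partial>em_law n h \<mu> \<sigma> \<rho>) =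
    (\<integral>\<^sup>+x. chain_weight (\<lambda>x. ennreal (\<rho> x)) (\<lambda>k x y. ennreal (p k x y)) n x * f x \<partial>leb_paths {..n})"
  using assms
proof (induction n arbitrary: f)
  case 0
  have I: "{..0::nat} = {0}" by auto
  let ?u = "\<lambda>_::nat. undefined :: 'a"
  have f: "f \<in> borel_measurable (leb_paths (insert 0 {}))"
    using "0.prems" by (simp add: I)
  have "(\<lambda>y. ?u(0 := y)) \<in> lborel \<rightarrow>\<^sub>M leb_paths {0}"
    by (rule measurable_fun_upd[where J="{}"]) (auto simp: measurable_def space_PiM PiM_empty)
  from measurable_compose[OF this f[simplified]]
  have f': "(\<lambda>y. f (?u(0 := y))) \<in> borel_measurable borel" by simp
  have r: "restrict (em_chain h \<mu> \<sigma> y z) {0} = ?u(0 := y)" for y z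
    by (auto simp: fun_eq_iff)
  interpret noise: prob_space "noise 0"
    by (intro prob_space_PiM prob_space_std_gaussian)
  have c: "(\<lambda>x. chain_weight (\<lambda>x. ennreal (\<rho> x)) (\<lambda>k x y. ennreal (p k x y)) 0 x * f x) \<in>
      borel_measurable (leb_paths (insert 0 {}))"
    using f by (simp add: chain_weight_def)
  have "(\<integral>\<^sup>+x. f x \<partial>em_law 0 h \<mu> \<sigma> \<rho>) = (\<integral>\<^sup>+y. f (?u(0 := y)) \<partial>initial)"
    using "0.prems" by (subst nn_integral_em_law) (simp_all add: I r noise.emeasure_space_1[simplified])
  also have "\<dots> = (\<integral>\<^sup>+y. ennreal (\<rho> y) * f (?u(0 := y)) \<partial>lborel)"
    using f' by (intro nn_integral_density) auto
  also have "\<dots> = (\<integral>\<^sup>+x. chain_weight (\<lambda>x. ennreal (\<rho> x)) (\<lambda>k x y. ennreal (p k x y)) 0 x * f x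
      \<partial>leb_paths (insert 0 {}))"
    by (subst lborel_paths.product_nn_integral_insert_rev[OF _ _ c])
      (simp_all add: chain_weight_def PiM_empty nn_integral_count_space_finite fun_upd_def)
  finally show ?case by (simp add: I)
next
  case (Suc n)
  let ?W = "chain_weight (\<lambda>x. ennreal (\<rho> x)) (\<lambda>k x y. ennreal (p k x y))"
  have p_n: "distributed std_gaussian lborel (em_step h \<mu> \<sigma> n x) (\<lambda>y. ennreal (p n x y))" for x
    using Suc.prems(1) by (simp add: transition_density_def)
  have p_meas: "(\<lambda>(x, y). p k x y) \<in> borel_measurable (borel \<Otimes>\<^sub>M borel)" if "k \<le> n" for k
    using Suc.prems(1) that by (simp add: transition_density_def)
  have p': "transition_density n h \<mu> \<sigma> p"
    using Suc.prems(1) by (simp add: transition_density_def)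
  interpret chain_kernels "Suc n" "\<lambda>x. ennreal (\<rho> x)" "\<lambda>k x y. ennreal (p k x y)"
    using p_meas by unfold_locales (auto simp: case_prod_beta')
  have I: "{..Suc n} = insert (Suc n) {..n}" by auto
  have f: "f \<in> borel_measurable (leb_paths (insert (Suc n) {..n}))"
    using Suc.prems(2) by (simp add: I)
  have upd: "(\<lambda>z. (fst z)(Suc n := snd z)) \<in> leb_paths {..n} \<Otimes>\<^sub>M borel \<rightarrow>\<^sub>M leb_paths {..Suc n}"
    by (rule measurable_fun_upd[where J="{..n}"]) auto
  have f_upd: "(\<lambda>z. f ((fst z)(Suc n := snd z))) \<in> borel_measurable (leb_paths {..n} \<Otimes>\<^sub>M borel)"
    by (rule measurable_compose[OF upd Suc.prems(2)])
  have f_upd1: "(\<lambda>y. f (x(Suc n := y))) \<in> borel_measurable lborel" if "x \<in> space (leb_paths {..n})" for x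
    using measurable_compose[OF measurable_Pair1'[OF that, of borel] f_upd] by simp
  let ?g = "\<lambda>x. \<integral>\<^sup>+y. ennreal (p n (x n) y) * f (x(Suc n := y)) \<partial>lborel"
  have "(\<lambda>z. ennreal (p n (fst z n) (snd z)) * f ((fst z)(Suc n := snd z)))
      \<in> borel_measurable (leb_paths {..n} \<Otimes>\<^sub>M lborel)"
    using f_upd by (intro borel_measurable_times_ennreal \<kappa>_compose
      measurable_compose[OF measurable_fst leb_paths_coordinate]) (auto simp: measurable_cong_sets[OF sets_pair_measure_cong[OF refl sets_lborel] refl])
  then have g: "?g \<in> borel_measurable (leb_paths {..n})"
    by (intro lborel.borel_measurable_nn_integral) (simp add: case_prod_beta')
  have cW: "(\<lambda>x. ?W (Suc n) x * f x) \<in> borel_measurable (leb_paths (insert (Suc n) {..n}))"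
    by (intro borel_measurable_times_ennreal f chain_weight_measurable) auto
  interpret noise: product_sigma_finite "\<lambda>_::nat. std_gaussian :: 'z measure"
    by (rule product_sigma_finite.intro, rule prob_space_imp_sigma_finite, rule prob_space_std_gaussian)
  let ?X = "\<lambda>y z. restrict (em_chain h \<mu> \<sigma> y z) {..n}"
  have step: "(\<integral>\<^sup>+z. f (restrict (em_chain h \<mu> \<sigma> y z) {..Suc n}) \<partial>noise (Suc n)) =
      (\<integral>\<^sup>+z. ?g (?X y z) \<partial>noise n)" for y
  proof -
    have J: "{..<Suc n} = insert n {..<n}" by auto
    have "(\<lambda>z. f (case (y, z) of (y, z) \<Rightarrow> restrict (em_chain h \<mu> \<sigma> y z) {..Suc n}))
        \<in> borel_measurable (noise (Suc n))"
      using Suc.prems(2)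
      by (intro measurable_compose[OF measurable_compose[OF measurable_Pair1'[of y] em_path_measurable]])
        (simp_all add: measurable_cong_sets[OF sets_leb_paths refl])
    then have m: "(\<lambda>z. f (restrict (em_chain h \<mu> \<sigma> y z) {..Suc n})) \<in> borel_measurable
        (Pi\<^sub>M (insert n {..<n}) (\<lambda>_. std_gaussian))"
      unfolding J by simp
    have path: "restrict (em_chain h \<mu> \<sigma> y (z(n := w))) {..Suc n} =
        (?X y z)(Suc n := em_step h \<mu> \<sigma> n (?X y z n) w)" for z w
      using em_chain_cong[of _ "z(n := w)" z h \<mu> \<sigma> y] by (auto simp: fun_eq_iff le_Suc_eq)
    have "(\<integral>\<^sup>+z. f (restrict (em_chain h \<mu> \<sigma> y z) {..Suc n}) \<partial>noise (Suc n)) =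
      (\<integral>\<^sup>+z. \<integral>\<^sup>+w. f ((?X y z)(Suc n := em_step h \<mu> \<sigma> n (?X y z n) w)) \<partial>std_gaussian \<partial>noise n)"
      unfolding J by (subst noise.product_nn_integral_insert[OF _ _ m]) (simp_all only: path finite_lessThan lessThan_iff less_irrefl not_False_eq_True)
    also have "\<dots> = (\<integral>\<^sup>+z. ?g (?X y z) \<partial>noise n)"
      by (intro nn_integral_cong distributed_nn_integral[OF p_n, symmetric] f_upd1) (auto simp: space_PiM)
    finally show ?thesis .
  qed
  have "(\<integral>\<^sup>+x. f x \<partial>em_law (Suc n) h \<mu> \<sigma> \<rho>) = (\<integral>\<^sup>+y. \<integral>\<^sup>+z. ?g (?X y z) \<partial>noise n \<partial>initial)"
    by (simp only: nn_integral_em_law[OF Suc.prems(2)] step)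
  also have "\<dots> = (\<integral>\<^sup>+x. ?g x \<partial>em_law n h \<mu> \<sigma> \<rho>)"
    by (rule nn_integral_em_law[OF g, symmetric])
  also have "\<dots> = (\<integral>\<^sup>+x. ?W n x * ?g x \<partial>leb_paths {..n})"
    by (rule Suc.IH[OF p' g])
  also have "\<dots> = (\<integral>\<^sup>+x. \<integral>\<^sup>+y. ?W (Suc n) (x(Suc n := y)) * f (x(Suc n := y)) \<partial>lborel \<partial>leb_paths {..n})"
  proof (intro nn_integral_cong)
    fix x :: "nat \<Rightarrow> 'a" assume x: "x \<in> space (leb_paths {..n})"
    have "?W n (x(Suc n := y)) = ?W n x" for y
      by (rule chain_weight_cong) auto
    then have "?W (Suc n) (x(Suc n := y)) * f (x(Suc n := y)) =
        ?W n x * (ennreal (p n (x n) y) * f (x(Suc n := y)))" for y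
      by (simp add: chain_weight_Suc mult.assoc)
    moreover have "(\<lambda>y. ennreal (p n (x n) y) * f (x(Suc n := y))) \<in> borel_measurable lborel"
      by (intro borel_measurable_times_ennreal \<kappa>_compose f_upd1 x) auto
    ultimately show "?W n x * ?g x =
        (\<integral>\<^sup>+y. ?W (Suc n) (x(Suc n := y)) * f (x(Suc n := y)) \<partial>lborel)"
      by (simp add: nn_integral_cmult)
  qed
  also have "\<dots> = (\<integral>\<^sup>+x. ?W (Suc n) x * f x \<partial>leb_paths {..Suc n})"
    unfolding I by (rule lborel_paths.product_nn_integral_insert[OF _ _ cW, symmetric]) auto
  finally show ?case .
qed

lemma em_law_eq_density:
  assumes p: "transition_density n h \<mu> \<sigma> p"
  shows "em_law n h \<mu> \<sigma> \<rho> = density (leb_paths {..n})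
    (chain_weight (\<lambda>x. ennreal (\<rho> x)) (\<lambda>k x y. ennreal (p k x y)) n)"
proof (rule measure_eqI)
  interpret chain_kernels n "\<lambda>x. ennreal (\<rho> x)" "\<lambda>k x y. ennreal (p k x y)"
    using p by unfold_locales (auto simp: case_prod_beta' transition_density_def)
  show sets: "sets (em_law n h \<mu> \<sigma> \<rho>) = sets (density (leb_paths {..n})
      (chain_weight (\<lambda>x. ennreal (\<rho> x)) (\<lambda>k x y. ennreal (p k x y)) n))"
    by (simp add: em_law_def sets_leb_paths)
  fix A assume A: "A \<in> sets (em_law n h \<mu> \<sigma> \<rho>)"
  then have A': "A \<in> sets (leb_paths {..n})"
    using sets by simp
  show "emeasure (em_law n h \<mu> \<sigma> \<rho>) A = emeasure (density (leb_paths {..n})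
      (chain_weight (\<lambda>x. ennreal (\<rho> x)) (\<lambda>k x y. ennreal (p k x y)) n)) A"
    using nn_integral_em_law_density[OF p, of "indicator A"] A A'
    by (simp add: emeasure_density chain_weight_measurable)
qed

end

section \<open>Exponentials of extended real potentials\<close>

lemma exp_ereal_add_real: "exp_ereal (a + ereal r) = exp_ereal a * ennreal (exp r)"
  by (cases a) (simp_all add: exp_ereal_def exp_add ennreal_mult ennreal_top_mult)

lemma exp_ereal_log_ennreal: "exp_ereal (log_ennreal u) = u"
  by (cases u) (auto simp: exp_ereal_def log_ennreal_def)

text \<open>In the extended reals \<open>-\<infinity> + \<infinity> = \<infinity>\<close>, so the exponential of a sum of logarithms is not the product in
  general: a vanishing forward weight beside an infinite backward weight would give \<open>\<infinity>\<close> instead of \<open>0\<close>.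
  A second summand that is a real number rules this out.\<close>

lemma exp_ereal_add_log_ennreal:
  assumes "0 < u" "u < \<infinity>"
  shows "exp_ereal (a + log_ennreal u) = exp_ereal a * u"
  using assms by (cases u) (auto simp: log_ennreal_def exp_ereal_add_real)

section \<open>Regularity of the summands of the tilt\<close>

text \<open>Constant paths and paths with a single jump suffice to isolate the summands of \<open>\<Delta>\<close>, for potentials
  with a single nonzero component.\<close>

lemma bounded_continuous_paths_two_values:
  assumes "f \<in> bounded_continuous_paths n"
  shows "continuous_on UNIV (\<lambda>(x, y). f (\<lambda>j\<in>{..n}. if j \<le> k then x else y))"
    and "bounded (range (\<lambda>(x, y). f (\<lambda>j\<in>{..n}. if j \<le> k then x else y)))"
proof -
  let ?q = "\<lambda>z. \<lambda>j\<in>{..n}. if j \<le> k then fst z else snd z"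
  have "continuous_map euclidean (product_topology (\<lambda>_. euclidean) {..n}) (?q :: 'a \<times> 'a \<Rightarrow> nat \<Rightarrow> 'a)"
    by (auto simp: continuous_map_componentwise intro!: continuous_intros)
  from continuous_map_compose[OF this, of euclideanreal f] assms
  show "continuous_on UNIV (\<lambda>(x, y). f (\<lambda>j\<in>{..n}. if j \<le> k then x else y))"
    by (auto simp: bounded_continuous_paths_def o_def case_prod_beta')
  have "bounded (f ` (\<Pi>\<^sub>E j\<in>{..n}. UNIV))"
    using assms by (simp add: bounded_continuous_paths_def)
  then show "bounded (range (\<lambda>(x, y). f (\<lambda>j\<in>{..n}. if j \<le> k then x else y)))"
    by (rule bounded_subset) auto
qed

lemma Delta_regroup:
  assumes \<tau>: "\<And>i. \<tau> i \<le> n"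
  shows "Delta n h B G \<tau> (\<phi>\<nu>, \<phi>b, lam) x = (\<Sum>k\<le>n. h * \<phi>\<nu> k (x k))
    + (\<Sum>k<n. Delta_step B \<phi>b k (x k) (x (Suc k))) + (\<Sum>k\<le>n. Lambda_G G \<tau> lam k (x k))"
proof -
  have "(\<Sum>i\<in>UNIV. lam $ i * G i (x (\<tau> i))) = (\<Sum>k\<le>n. \<Sum>i\<in>{i\<in>UNIV. \<tau> i = k}. lam $ i * G i (x (\<tau> i)))"
    using \<tau> by (intro sum.group[symmetric]) auto
  also have "\<dots> = (\<Sum>k\<le>n. Lambda_G G \<tau> lam k (x k))"
    by (auto simp: Lambda_G_def intro!: sum.cong)
  finally show ?thesis
    by (simp add: Delta_def Delta_step_def)
qed

text \<open>Apply the hypothesis on \<open>\<Delta>\<close> to the potentials that keep only the multipliers of instruments expiring at \<open>k\<close>.\<close>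

lemma Lambda_G_continuous_bounded:
  assumes \<tau>: "\<And>i. \<tau> i \<le> n"
    and BG: "\<And>\<Psi>. Delta n h B G \<tau> \<Psi> \<in> bounded_continuous_paths n"
  shows "continuous_on UNIV (Lambda_G G \<tau> lam k)" and "bounded (range (Lambda_G G \<tau> lam k))"
proof -
  let ?\<Psi> = "(\<lambda>_. 0, \<lambda>_. 0, \<chi> i. if \<tau> i = k then lam $ i else 0)"
  have eq: "Delta n h B G \<tau> ?\<Psi> (\<lambda>j\<in>{..n}. if j \<le> n then x else y) = Lambda_G G \<tau> lam k x" for x y
  proof -
    have "Delta n h B G \<tau> ?\<Psi> q = Lambda_G G \<tau> lam k x" if "\<And>i. q (\<tau> i) = x" for q
      unfolding Delta_def prod.case that
      by (simp add: Lambda_G_def if_distrib[of "\<lambda>c. c * _"] sum.If_cases)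
    then show ?thesis
      using \<tau> by simp
  qed
  note * = bounded_continuous_paths_two_values[OF BG[of ?\<Psi>], of n, unfolded eq]
  have "continuous_on UNIV ((\<lambda>(x, y). Lambda_G G \<tau> lam k x) \<circ> (\<lambda>x. (x, x)))"
    by (intro continuous_on_compose continuous_on_subset[OF *(1)] continuous_intros) auto
  then show "continuous_on UNIV (Lambda_G G \<tau> lam k)"
    by (simp add: o_def)
  show "bounded (range (Lambda_G G \<tau> lam k))"
    by (rule bounded_subset[OF *(2)]) force
qed

text \<open>Apply the hypothesis on \<open>\<Delta>\<close> to the potentials whose only nonzero component is \<open>\<phi>b k\<close>.\<close>

lemma Delta_step_continuous_bounded:
  assumes k: "k < n"
    and BG: "\<And>\<Psi>. Delta n h B G \<tau> \<Psi> \<in> bounded_continuous_paths n"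
  shows "continuous_on UNIV (\<lambda>(x, y). Delta_step B \<phi>b k x y)"
    and "bounded (range (\<lambda>(x, y). Delta_step B \<phi>b k x y))"
proof -
  let ?\<Psi> = "(\<lambda>_. 0, \<lambda>j. if j = k then \<phi>b k else 0, 0)"
  have eq: "Delta n h B G \<tau> ?\<Psi> (\<lambda>j\<in>{..n}. if j \<le> k then x else y) = Delta_step B \<phi>b k x y" for x y
  proof -
    let ?q = "\<lambda>j\<in>{..n}. if j \<le> k then x else y"
    have "(\<Sum>j<n. B (?q j) (?q (Suc j)) \<bullet> (if j = k then \<phi>b k else 0) (?q j)) =
        (\<Sum>j<n. if j = k then Delta_step B \<phi>b k x y else 0)"
      using k by (intro sum.cong) (auto simp: Delta_step_def)
    then show ?thesis
      using k by (simp add: Delta_def)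
  qed
  note * = bounded_continuous_paths_two_values[OF BG[of ?\<Psi>], of k, unfolded eq]
  show "continuous_on UNIV (\<lambda>(x, y). Delta_step B \<phi>b k x y)" by (rule *(1))
  show "bounded (range (\<lambda>(x, y). Delta_step B \<phi>b k x y))" by (rule *(2))
qed

text \<open>The backward potential attaches the weight of a state to the step arriving there, the forward potential to
  the step leaving it.  Moving all weights by one step changes the product only at its two ends.\<close>

lemma prod_exp_shift:
  fixes w d q :: "nat \<Rightarrow> real"
  shows "(\<Prod>k<i. exp (d k + w k) * q k) = exp (w 0) * (\<Prod>k<i. exp (d k + w (Suc k)) * q k) * exp (- w i)"
  by (induction i) (simp_all add: exp_add exp_minus field_simps)

section \<open>Tilting the reference chain\<close>

text \<open>The weight \<open>\<phi>\<nu> k + \<Lambda>\<^sub>k \<cdot> G / h\<close> of the state at time \<open>k\<close> is attached to the kernel arriving at time \<open>k\<close>, as in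
  the backward potential; the weight at time \<open>0\<close> has no such kernel and goes to the initial density.\<close>

definition gibbs_initial :: "real \<Rightarrow> ('c::finite \<Rightarrow> 'a::topological_space \<Rightarrow> real) \<Rightarrow> ('c \<Rightarrow> nat) \<Rightarrow> ('a \<Rightarrow> real)
    \<Rightarrow> (nat \<Rightarrow> 'a \<Rightarrow>\<^sub>C real) \<Rightarrow> real^'c \<Rightarrow> 'a \<Rightarrow> ennreal"
  where "gibbs_initial h G \<tau> \<rho>\<^sub>0 \<phi>\<nu> lam x = ennreal (\<rho>\<^sub>0 x * exp (\<phi>\<nu> 0 x + Lambda_G G \<tau> lam 0 x / h))"

definition gibbs_kernel :: "real \<Rightarrow> ('a::topological_space \<Rightarrow> 'a \<Rightarrow> real^'k::finite) \<Rightarrow> ('c::finite \<Rightarrow> 'a \<Rightarrow> real)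
    \<Rightarrow> ('c \<Rightarrow> nat) \<Rightarrow> (nat \<Rightarrow> 'a \<Rightarrow> 'a \<Rightarrow> real) \<Rightarrow> (nat \<Rightarrow> 'a \<Rightarrow>\<^sub>C real) \<Rightarrow> (nat \<Rightarrow> 'a \<Rightarrow>\<^sub>C (real^'k))
    \<Rightarrow> real^'c \<Rightarrow> nat \<Rightarrow> 'a \<Rightarrow> 'a \<Rightarrow> ennreal"
  where "gibbs_kernel h B G \<tau> p \<phi>\<nu> \<phi>b lam k x y =
    ennreal (exp (Delta_step B \<phi>b k x y / h + \<phi>\<nu> (Suc k) y + Lambda_G G \<tau> lam (Suc k) y / h) * p k x y)"

text \<open>Grouping the instruments by expiry makes \<open>\<Delta>\<close> a sum over single states and single steps, so its
  exponential distributes over the factors of the path density.\<close>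

lemma chain_weight_reweighted:
  assumes \<tau>: "\<And>i. \<tau> i \<le> n" and h: "0 < h" and \<rho>: "\<And>x. 0 \<le> \<rho>\<^sub>0 x"
    and p: "\<And>k x y. k < n \<Longrightarrow> 0 \<le> p k x y"
  shows "chain_weight (\<lambda>x. ennreal (\<rho>\<^sub>0 x)) (\<lambda>k x y. ennreal (p k x y)) n x
      * ennreal (exp (Delta n h B G \<tau> (\<phi>\<nu>, \<phi>b, lam) x / h)) =
    chain_weight (gibbs_initial h G \<tau> \<rho>\<^sub>0 \<phi>\<nu> lam) (gibbs_kernel h B G \<tau> p \<phi>\<nu> \<phi>b lam) n x"
proof -
  let ?w = "\<lambda>k. \<phi>\<nu> k (x k) + Lambda_G G \<tau> lam k (x k) / h"
  let ?d = "\<lambda>k. Delta_step B \<phi>b k (x k) (x (Suc k)) / h"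
  have "Delta n h B G \<tau> (\<phi>\<nu>, \<phi>b, lam) x / h = (\<Sum>k\<le>n. ?w k) + (\<Sum>k<n. ?d k)"
    using h by (simp add: Delta_regroup[OF \<tau>] sum.distrib sum_distrib_left[symmetric]
        sum_divide_distrib[symmetric] add_divide_distrib)
  also have "\<dots> = ?w 0 + (\<Sum>k<n. ?d k + ?w (Suc k))"
    by (simp only: sum.atMost_shift sum.distrib ac_simps)
  finally have tilt: "ennreal (exp (Delta n h B G \<tau> (\<phi>\<nu>, \<phi>b, lam) x / h)) =
      ennreal (exp (?w 0)) * (\<Prod>k<n. ennreal (exp (?d k + ?w (Suc k))))"
    by (simp only: exp_add[of "?w 0"] exp_sum[OF finite_lessThan] ennreal_mult'[OF exp_ge_zero]
        prod_ennreal[OF exp_ge_zero])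
  have initial: "gibbs_initial h G \<tau> \<rho>\<^sub>0 \<phi>\<nu> lam (x 0) = ennreal (\<rho>\<^sub>0 (x 0)) * ennreal (exp (?w 0))"
    by (simp only: gibbs_initial_def ennreal_mult'' exp_ge_zero)
  have kernel: "gibbs_kernel h B G \<tau> p \<phi>\<nu> \<phi>b lam k (x k) (x (Suc k)) =
      ennreal (exp (?d k + ?w (Suc k))) * ennreal (p k (x k) (x (Suc k)))" for k
    by (simp only: gibbs_kernel_def add.assoc ennreal_mult' exp_ge_zero)
  show ?thesis
    unfolding chain_weight_def tilt initial kernel prod.distrib by (simp only: mult.assoc mult.commute mult.left_commute)
qed

lemma ennreal_mult_prod:
  assumes "0 \<le> a" "\<And>k. k < i \<Longrightarrow> 0 \<le> f k" "0 \<le> c"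
  shows "ennreal (a * (\<Prod>k<i. f k) * c) = ennreal a * (\<Prod>k<i. ennreal (f k)) * ennreal c"
proof -
  have "ennreal (\<Prod>k<i. f k) = (\<Prod>k<i. ennreal (f k))"
    using assms(2) by (intro prod_ennreal[symmetric]) auto
  moreover have "0 \<le> (\<Prod>k<i. f k)"
    using assms(2) by (intro prod_nonneg) auto
  ultimately show ?thesis
    by (simp only: ennreal_mult mult_nonneg_nonneg assms(1,3))
qed

lemma psi_d_eq:
  assumes p: "\<And>k x y. k < n \<Longrightarrow> 0 \<le> p k x y"
  shows "psi_d n h B G \<tau> p (\<phi>\<nu>, \<phi>b, lam) i x =
    log_ennreal (backward_weight n (gibbs_kernel h B G \<tau> p \<phi>\<nu> \<phi>b lam) i x)"
proof -
  have "(let y = z(i := x) in ennreal (\<Prod>k\<in>{i..<n}.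
         exp (Delta_step B \<phi>b k (y k) (y (Suc k)) / h + \<phi>\<nu> (Suc k) (y (Suc k))
              + Lambda_G G \<tau> lam (Suc k) (y (Suc k)) / h) * p k (y k) (y (Suc k)))) =
    (\<Prod>k\<in>{i..<n}. gibbs_kernel h B G \<tau> p \<phi>\<nu> \<phi>b lam k ((z(i := x)) k) ((z(i := x)) (Suc k)))" for z
    unfolding gibbs_kernel_def Let_def using p by (intro prod_ennreal[symmetric]) auto
  then show ?thesis
    unfolding psi_d_def backward_weight_def prod.case by simp
qed

text \<open>The forward potential lacks the weight of its final state \<open>x\<close>, because weights there sit on departing
  steps; the exponential on the left restores it.\<close>

lemma exp_psi_u_eq:
  assumes "chain_kernels n (gibbs_initial h G \<tau> \<rho>\<^sub>0 \<phi>\<nu> lam) (gibbs_kernel h B G \<tau> p \<phi>\<nu> \<phi>b lam)"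
    and \<rho>: "\<And>x. 0 \<le> \<rho>\<^sub>0 x" and p: "\<And>k x y. k < n \<Longrightarrow> 0 \<le> p k x y" and i: "i \<le> n"
  shows "exp_ereal (psi_u h B G \<tau> \<rho>\<^sub>0 p (\<phi>\<nu>, \<phi>b, lam) i x)
      * ennreal (exp (\<phi>\<nu> i x + Lambda_G G \<tau> lam i x / h)) =
    forward_weight (gibbs_initial h G \<tau> \<rho>\<^sub>0 \<phi>\<nu> lam) (gibbs_kernel h B G \<tau> p \<phi>\<nu> \<phi>b lam) i x"
    (is "_ * ennreal (exp ?e) = forward_weight ?a ?\<kappa> i x")
proof -
  interpret chain_kernels n ?a ?\<kappa> by (rule assms(1))
  have "(let y = z(i := x) in ennreal (\<rho>\<^sub>0 (y 0) *
         (\<Prod>k<i. exp (Delta_step B \<phi>b k (y k) (y (Suc k)) / h + \<phi>\<nu> k (y k)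
                     + Lambda_G G \<tau> lam k (y k) / h) * p k (y k) (y (Suc k))))) =
      chain_weight ?a ?\<kappa> i (z(i := x)) * ennreal (exp (- ?e))" for z
  proof -
    let ?y = "z(i := x)"
    let ?w = "\<lambda>k. \<phi>\<nu> k (?y k) + Lambda_G G \<tau> lam k (?y k) / h"
    let ?d = "\<lambda>k. Delta_step B \<phi>b k (?y k) (?y (Suc k)) / h"
    let ?q = "\<lambda>k. p k (?y k) (?y (Suc k))"
    have q: "0 \<le> ?q k" if "k < i" for k
      using that i p by simp
    have real: "\<rho>\<^sub>0 (?y 0) * (\<Prod>k<i. exp (?d k + ?w k) * ?q k) =
        \<rho>\<^sub>0 (?y 0) * exp (?w 0) * (\<Prod>k<i. exp (?d k + ?w (Suc k)) * ?q k) * exp (- ?w i)"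
      using prod_exp_shift[of ?d ?w ?q i] by (simp only: mult.assoc)
    have split: "ennreal (\<rho>\<^sub>0 (?y 0) * exp (?w 0) * (\<Prod>k<i. exp (?d k + ?w (Suc k)) * ?q k) * exp (- ?w i))
        = ennreal (\<rho>\<^sub>0 (?y 0) * exp (?w 0))
        * (\<Prod>k<i. ennreal (exp (?d k + ?w (Suc k)) * ?q k)) * ennreal (exp (- ?w i))"
      by (rule ennreal_mult_prod[of "\<rho>\<^sub>0 (?y 0) * exp (?w 0)" i
          "\<lambda>k. exp (?d k + ?w (Suc k)) * ?q k" "exp (- ?w i)"])
        (simp_all only: mult_nonneg_nonneg \<rho> q exp_ge_zero)
    show ?thesis
      using trans[OF arg_cong[OF real, of ennreal] split]
      unfolding Let_def chain_weight_def gibbs_initial_def gibbs_kernel_def add.assoc fun_upd_same .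
  qed
  then have "exp_ereal (psi_u h B G \<tau> \<rho>\<^sub>0 p (\<phi>\<nu>, \<phi>b, lam) i x) =
      (\<integral>\<^sup>+z. chain_weight ?a ?\<kappa> i (z(i := x)) * ennreal (exp (- ?e)) \<partial>leb_paths {..<i})"
    unfolding psi_u_def prod.case by (simp only: exp_ereal_log_ennreal)
  also have "\<dots> = forward_weight ?a ?\<kappa> i x * ennreal (exp (- ?e))"
    unfolding forward_weight_def by (intro nn_integral_multc forward_integrand_measurable i)
  finally show ?thesis
    by (simp add: mult.assoc ennreal_mult'[symmetric] flip: exp_add)
qed

lemma integral_transition_density:
  assumes "transition_density n h \<mu> \<sigma> p" "k < n"
  shows "(\<integral>\<^sup>+y. ennreal (p k x y) \<partial>lborel) = 1"
proof -
  have "distributed std_gaussian lborel (em_step h \<mu> \<sigma> k x) (\<lambda>y. ennreal (p k x y))"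
    using assms by (simp add: transition_density_def)
  from distributed_nn_integral[OF this, of "\<lambda>_. 1"] show ?thesis
    by (simp add: prob_space.emeasure_space_1[OF prob_space_std_gaussian])
qed

text \<open>The transition density has mass one and the exponent is bounded, so the mass of the tilted kernel lies
  between \<open>exp (- b)\<close> and \<open>exp b\<close>, uniformly in the starting state, for a bound \<open>b\<close> of the exponent.\<close>

lemma gibbs_kernel_integral_bounds:
  assumes p: "transition_density n h \<mu> \<sigma> p" and k: "k < n" and \<tau>: "\<And>i. \<tau> i \<le> n"
    and BG: "\<And>\<Psi>. Delta n h B G \<tau> \<Psi> \<in> bounded_continuous_paths n"
  shows "\<exists>c C::real. 0 < c \<and>
    (\<forall>x. ennreal c \<le> (\<integral>\<^sup>+y. gibbs_kernel h B G \<tau> p \<phi>\<nu> \<phi>b lam k x y \<partial>lborel) \<and>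
      (\<integral>\<^sup>+y. gibbs_kernel h B G \<tau> p \<phi>\<nu> \<phi>b lam k x y \<partial>lborel) \<le> ennreal C)"
proof -
  have p_nonneg: "0 \<le> p k x y" for x y
    using p k by (simp add: transition_density_def)
  have p_meas: "(\<lambda>y. ennreal (p k x y)) \<in> borel_measurable lborel" for x
    using p k by (auto simp: transition_density_def dest!: distributed_borel_measurable)
  obtain b1 where b1: "\<And>x y. \<bar>Delta_step B \<phi>b k x y\<bar> \<le> b1"
    using Delta_step_continuous_bounded(2)[OF k BG, of \<phi>b] by (auto simp: bounded_iff)
  obtain b2 where b2: "\<And>y. \<bar>Lambda_G G \<tau> lam (Suc k) y\<bar> \<le> b2"
    using Lambda_G_continuous_bounded(2)[OF \<tau> BG, of lam "Suc k"] by (auto simp: bounded_iff)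
  define b where "b = b1 / \<bar>h\<bar> + norm (\<phi>\<nu> (Suc k)) + b2 / \<bar>h\<bar>"
  let ?e = "\<lambda>x y. Delta_step B \<phi>b k x y / h + \<phi>\<nu> (Suc k) y + Lambda_G G \<tau> lam (Suc k) y / h"
  have abs_e: "\<bar>?e x y\<bar> \<le> b" for x y
  proof -
    have "\<bar>?e x y\<bar> \<le> \<bar>Delta_step B \<phi>b k x y / h\<bar> + \<bar>\<phi>\<nu> (Suc k) y\<bar> + \<bar>Lambda_G G \<tau> lam (Suc k) y / h\<bar>"
      by linarith
    also have "\<dots> \<le> b"
      unfolding b_def abs_divide using norm_bounded[of "\<phi>\<nu> (Suc k)" y]
      by (intro add_mono divide_right_mono b1 b2) auto
    finally show ?thesis .
  qed
  have e: "exp (- b) \<le> exp (?e x y)" "exp (?e x y) \<le> exp b" for x y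
    unfolding exp_le_cancel_iff
    by (rule minus_le_iff[THEN iffD1, OF abs_le_D2[OF abs_e]], rule abs_le_D1[OF abs_e])
  have const: "(\<integral>\<^sup>+y. ennreal (c * p k x y) \<partial>lborel) = ennreal c" if "0 \<le> c" for c x
    using that nn_integral_cmult[OF p_meas, of "ennreal c" x] integral_transition_density[OF p k]
    by (simp add: ennreal_mult p_nonneg)
  show ?thesis
  proof (rule exI[of _ "exp (- b)"], rule exI[of _ "exp b"], intro conjI allI)
    fix x
    have "ennreal (exp (- b)) = (\<integral>\<^sup>+y. ennreal (exp (- b) * p k x y) \<partial>lborel)"
      by (simp add: const)
    also have "\<dots> \<le> (\<integral>\<^sup>+y. gibbs_kernel h B G \<tau> p \<phi>\<nu> \<phi>b lam k x y \<partial>lborel)"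
      unfolding gibbs_kernel_def by (intro nn_integral_mono ennreal_leI mult_right_mono e p_nonneg)
    finally show "ennreal (exp (- b)) \<le> (\<integral>\<^sup>+y. gibbs_kernel h B G \<tau> p \<phi>\<nu> \<phi>b lam k x y \<partial>lborel)" .
    have "(\<integral>\<^sup>+y. gibbs_kernel h B G \<tau> p \<phi>\<nu> \<phi>b lam k x y \<partial>lborel) \<le>
        (\<integral>\<^sup>+y. ennreal (exp b * p k x y) \<partial>lborel)"
      unfolding gibbs_kernel_def by (intro nn_integral_mono ennreal_leI mult_right_mono e p_nonneg)
    then show "(\<integral>\<^sup>+y. gibbs_kernel h B G \<tau> p \<phi>\<nu> \<phi>b lam k x y \<partial>lborel) \<le> ennreal (exp b)"
      by (simp add: const)
  qed simp
qed

lemma chain_kernels_gibbs: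
  assumes p: "transition_density n h \<mu> \<sigma> p" and \<tau>: "\<And>i. \<tau> i \<le> n"
    and \<rho> [measurable]: "\<rho>\<^sub>0 \<in> borel_measurable borel"
    and BG: "\<And>\<Psi>. Delta n h B G \<tau> \<Psi> \<in> bounded_continuous_paths n"
  shows "chain_kernels n (gibbs_initial h G \<tau> \<rho>\<^sub>0 \<phi>\<nu> lam) (gibbs_kernel h B G \<tau> p \<phi>\<nu> \<phi>b lam)"
proof
  have [measurable]: "Lambda_G G \<tau> lam k \<in> borel_measurable borel" for k
    by (rule borel_measurable_continuous_onI[OF Lambda_G_continuous_bounded(1)[OF \<tau> BG]])
  have [measurable]: "apply_bcontfun (\<phi>\<nu> k) \<in> borel_measurable borel" for k
    by (rule borel_measurable_continuous_onI) simp
  show "gibbs_initial h G \<tau> \<rho>\<^sub>0 \<phi>\<nu> lam \<in> borel_measurable borel"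
    unfolding gibbs_initial_def[abs_def] by measurable
  fix k assume k: "k < n"
  have [measurable]: "(\<lambda>z. Delta_step B \<phi>b k (fst z) (snd z)) \<in> borel_measurable (borel \<Otimes>\<^sub>M borel)"
    using borel_measurable_continuous_onI[OF Delta_step_continuous_bounded(1)[OF k BG, of \<phi>b]]
    by (simp add: borel_prod case_prod_beta')
  have [measurable]: "(\<lambda>z. p k (fst z) (snd z)) \<in> borel_measurable (borel \<Otimes>\<^sub>M borel)"
    using p k by (simp add: transition_density_def case_prod_beta')
  show "(\<lambda>(x, y). gibbs_kernel h B G \<tau> p \<phi>\<nu> \<phi>b lam k x y) \<in> borel_measurable (borel \<Otimes>\<^sub>M borel)"
    unfolding gibbs_kernel_def case_prod_beta' by measurable
qed

lemma Delta_measurable: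
  assumes \<tau>: "\<And>i. \<tau> i \<le> n"
    and BG: "\<And>\<Psi>. Delta n h B G \<tau> \<Psi> \<in> bounded_continuous_paths n"
  shows "Delta n h B G \<tau> (\<phi>\<nu>, \<phi>b, lam) \<in> borel_measurable (leb_paths {..n})"
proof -
  have G: "Lambda_G G \<tau> lam k \<in> borel_measurable borel" for k
    by (rule borel_measurable_continuous_onI[OF Lambda_G_continuous_bounded(1)[OF \<tau> BG]])
  have \<phi>: "apply_bcontfun (\<phi>\<nu> k) \<in> borel_measurable borel" for k
    by (rule borel_measurable_continuous_onI) simp
  have B: "(\<lambda>x. Delta_step B \<phi>b k (x k) (x (Suc k))) \<in> borel_measurable (leb_paths {..n})" if k: "k < n" for k
  proof -
    have "(\<lambda>x. (x k, x (Suc k))) \<in> leb_paths {..n} \<rightarrow>\<^sub>M borel"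
      unfolding borel_prod[symmetric] using k by (auto intro!: leb_paths_coordinate measurable_Pair)
    from measurable_compose[OF this borel_measurable_continuous_onI[OF Delta_step_continuous_bounded(1)[OF k BG, of \<phi>b]]]
    show ?thesis by simp
  qed
  show ?thesis
    unfolding Delta_regroup[OF \<tau>, abs_def]
    by (intro borel_measurable_add borel_measurable_sum borel_measurable_times borel_measurable_const
      B measurable_compose[OF leb_paths_coordinate G] measurable_compose[OF leb_paths_coordinate \<phi>]) auto
qed

section \<open>Marginals and Markov property of the optimal measure\<close>

theorem proposition4p3:
  fixes NT :: nat and h :: real
    and \<mu> :: "'a::euclidean_space \<Rightarrow> real \<Rightarrow> 'a"
    and \<sigma> :: "'a \<Rightarrow> real \<Rightarrow> 'z::euclidean_space \<Rightarrow> 'a"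
    and \<rho>\<^sub>0 :: "'a \<Rightarrow> real"
    and p :: "nat \<Rightarrow> 'a \<Rightarrow> 'a \<Rightarrow> real"
    and B :: "'a \<Rightarrow> 'a \<Rightarrow> real^'k::finite"
    and G :: "'c::finite \<Rightarrow> 'a \<Rightarrow> real"
    and \<tau> :: "'c \<Rightarrow> nat"
    and Fmom :: "nat \<Rightarrow> ('a set \<Rightarrow> real) \<times> ('a set \<Rightarrow> real^'k) \<Rightarrow> ereal"
    and Mf :: "nat \<Rightarrow> ('a set \<Rightarrow> real) \<Rightarrow> ereal"
    and Cf :: "'c \<Rightarrow> real \<Rightarrow> ereal"
    and F :: "('a, 'k, 'c) moments \<Rightarrow> ereal"
    and R P :: "(nat \<Rightarrow> 'a) measure"
    and \<phi>\<nu> :: "nat \<Rightarrow> 'a \<Rightarrow>\<^sub>C real"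
    and \<phi>b :: "nat \<Rightarrow> 'a \<Rightarrow>\<^sub>C (real^'k)"
    and lam :: "real^'c"
    and \<Phi> :: "('a, 'k, 'c) potentials"
  defines "F \<equiv> F_total NT Fmom Mf Cf"
    and "R \<equiv> em_law NT h \<mu> \<sigma> \<rho>\<^sub>0"
    and "\<Phi> \<equiv> (\<phi>\<nu>, \<phi>b, lam)"
  assumes NT: "1 \<le> NT" and h: "0 < h"
    and \<mu>: "\<And>t. (\<lambda>x. \<mu> x t) \<in> borel_measurable borel"
    and \<sigma>: "\<And>t z. (\<lambda>x. \<sigma> x t z) \<in> borel_measurable borel" "\<And>x t. linear (\<sigma> x t)"
    and \<rho>\<^sub>0: "\<rho>\<^sub>0 \<in> borel_measurable borel" "\<And>x. 0 \<le> \<rho>\<^sub>0 x"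
            "(\<integral>\<^sup>+x. ennreal (\<rho>\<^sub>0 x) \<partial>lborel) = 1"
    and p: "transition_density NT h \<mu> \<sigma> p"
    and \<tau>: "\<And>i. \<tau> i \<le> NT"
    and BG: "\<And>\<Psi> :: ('a, 'k, 'c) potentials. Delta NT h B G \<tau> \<Psi> \<in> bounded_continuous_paths NT"
    and Fmom: "\<And>k. k < NT \<Longrightarrow> convex_lsc (prod_topology signed_topology vector_topology) mix_pair (Fmom k)"
    and Mf: "\<And>k. k \<le> NT \<Longrightarrow> convex_lsc signed_topology mix_measure (Mf k)"
    and Cf: "\<And>i. convex_lsc euclideanreal mix (Cf i)"
    and proper: "\<exists>m\<in>moment_space NT. F m \<noteq> \<infinity>"
    and dual_max: "\<And>\<Psi>. dual_objective NT h B G \<tau> R F \<Psi> \<le> dual_objective NT h B G \<tau> R F \<Phi>"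
    and P: "P \<in> finite_path_measures NT"
    and primal_min: "\<And>Q. Q \<in> finite_path_measures NT \<Longrightarrow>
            primal_objective h B G \<tau> R F P \<le> primal_objective h B G \<tau> R F Q"
    and P_prob: "prob_space P"
    and P_density: "P = density R (\<lambda>x. ennreal (exp (Delta NT h B G \<tau> \<Phi> x / h)))"
  shows "(\<forall>i<NT. distributed P (lborel \<Otimes>\<^sub>M lborel) (\<lambda>x. (x i, x (Suc i)))
            (\<lambda>(x, y). exp_ereal
               (psi_u h B G \<tau> \<rho>\<^sub>0 p \<Phi> i x + ereal (\<phi>\<nu> i x) + ereal (1 / h * Lambda_G G \<tau> lam i x)
                + ereal (1 / h * Delta_step B \<phi>b i x y)
                + ereal (1 / h * Lambda_G G \<tau> lam (Suc i) y) + ereal (\<phi>\<nu> (Suc i) y)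
                + psi_d NT h B G \<tau> p \<Phi> (Suc i) y)
              * ennreal (p i x y)))
         \<and> markovian NT P
         \<and> (\<forall>k\<le>NT. distributed P lborel (\<lambda>x. x k)
              (\<lambda>x. exp_ereal
                (psi_u h B G \<tau> \<rho>\<^sub>0 p \<Phi> k x + ereal (\<phi>\<nu> k x) + ereal (1 / h * Lambda_G G \<tau> lam k x)
                 + psi_d NT h B G \<tau> p \<Phi> k x)))"
proof -
  let ?a = "gibbs_initial h G \<tau> \<rho>\<^sub>0 \<phi>\<nu> lam"
  let ?\<kappa> = "gibbs_kernel h B G \<tau> p \<phi>\<nu> \<phi>b lam"
  have p_nonneg: "0 \<le> p k x y" if "k < NT" for k x y
    using p that by (simp add: transition_density_def)
  have kernels: "chain_kernels NT ?a ?\<kappa>"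
    by (rule chain_kernels_gibbs[OF p \<tau> \<rho>\<^sub>0(1) BG])
  then interpret chain_kernels NT ?a ?\<kappa> .
  interpret reference: chain_kernels NT "\<lambda>x. ennreal (\<rho>\<^sub>0 x)" "\<lambda>k x y. ennreal (p k x y)"
    using p \<rho>\<^sub>0 by unfold_locales (auto simp: case_prod_beta' transition_density_def)
  let ?W = "chain_weight (\<lambda>x. ennreal (\<rho>\<^sub>0 x)) (\<lambda>k x y. ennreal (p k x y)) NT"
  let ?E = "\<lambda>x. ennreal (exp (Delta NT h B G \<tau> \<Phi> x / h))"
  have R: "R = density (leb_paths {..NT}) ?W"
    unfolding R_def by (rule em_law_eq_density[OF \<mu> \<sigma> \<rho>\<^sub>0(1) p])
  have E_meas: "?E \<in> borel_measurable (leb_paths {..NT})"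
    unfolding \<Phi>_def by (intro measurable_compose[OF _ measurable_ennreal]
      measurable_compose[OF _ borel_measurable_exp] borel_measurable_divide Delta_measurable[OF \<tau> BG]) auto
  have P_eq: "P = density (leb_paths {..NT}) (chain_weight ?a ?\<kappa> NT)"
    unfolding P_density R
    by (subst density_density_eq[OF reference.chain_weight_measurable E_meas])
      (simp_all add: \<Phi>_def chain_weight_reweighted[OF \<tau> h \<rho>\<^sub>0(2) p_nonneg])
  have D: "0 < backward_weight NT ?\<kappa> k x \<and> backward_weight NT ?\<kappa> k x < \<infinity>" if k: "k \<le> NT" for k x
  proof -
    obtain c C :: real where "0 < c" "\<And>x. ennreal c \<le> backward_weight NT ?\<kappa> k x"
      "\<And>x. backward_weight NT ?\<kappa> k x \<le> ennreal C"
      using backward_weight_bounds[OF gibbs_kernel_integral_bounds[OF p _ \<tau> BG] k] by blast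
    then show ?thesis
      by (metis ennreal_less_zero_iff ennreal_less_top infinity_ennreal_def order_less_le_trans order_le_less_trans)
  qed
  have psi_d: "psi_d NT h B G \<tau> p \<Phi> k x = log_ennreal (backward_weight NT ?\<kappa> k x)" for k x
    unfolding \<Phi>_def by (rule psi_d_eq[OF p_nonneg])
  have psi_u: "exp_ereal (psi_u h B G \<tau> \<rho>\<^sub>0 p \<Phi> k x) * ennreal (exp (\<phi>\<nu> k x))
      * ennreal (exp (1 / h * Lambda_G G \<tau> lam k x)) = forward_weight ?a ?\<kappa> k x" if "k \<le> NT" for k x
    using exp_psi_u_eq[OF kernels \<rho>\<^sub>0(2) p_nonneg that, of x]
    by (simp add: \<Phi>_def exp_add ennreal_mult mult.assoc)
  have density_at: "forward_weight ?a ?\<kappa> k x * backward_weight NT ?\<kappa> k x =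
      exp_ereal (psi_u h B G \<tau> \<rho>\<^sub>0 p \<Phi> k x + ereal (\<phi>\<nu> k x) + ereal (1 / h * Lambda_G G \<tau> lam k x)
        + psi_d NT h B G \<tau> p \<Phi> k x)" if "k \<le> NT" for k x
    unfolding psi_d psi_u[OF that, symmetric] using D[OF that, of x]
    by (simp add: exp_ereal_add_log_ennreal exp_ereal_add_real)
  have density_pair: "forward_weight ?a ?\<kappa> i x * ?\<kappa> i x y * backward_weight NT ?\<kappa> (Suc i) y =
      exp_ereal (psi_u h B G \<tau> \<rho>\<^sub>0 p \<Phi> i x + ereal (\<phi>\<nu> i x) + ereal (1 / h * Lambda_G G \<tau> lam i x)
        + ereal (1 / h * Delta_step B \<phi>b i x y)
        + ereal (1 / h * Lambda_G G \<tau> lam (Suc i) y) + ereal (\<phi>\<nu> (Suc i) y)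
        + psi_d NT h B G \<tau> p \<Phi> (Suc i) y) * ennreal (p i x y)" if "i < NT" for i x y
  proof -
    have "?\<kappa> i x y = ennreal (exp (1 / h * Delta_step B \<phi>b i x y)) * ennreal (exp (1 / h * Lambda_G G \<tau> lam (Suc i) y))
        * ennreal (exp (\<phi>\<nu> (Suc i) y)) * ennreal (p i x y)"
      by (simp add: gibbs_kernel_def exp_add ennreal_mult'' ennreal_mult' ac_simps)
    moreover have "i \<le> NT" "Suc i \<le> NT"
      using that by auto
    ultimately show ?thesis
      unfolding psi_d psi_u[OF \<open>i \<le> NT\<close>, symmetric] using D[of "Suc i" y]
      by (simp add: exp_ereal_add_log_ennreal exp_ereal_add_real mult.assoc mult.commute mult.left_commute)
  qed
  show ?thesis
  proof (intro conjI allI impI)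
    fix i assume "i < NT"
    then show "distributed P (lborel \<Otimes>\<^sub>M lborel) (\<lambda>x. (x i, x (Suc i)))
            (\<lambda>(x, y). exp_ereal
               (psi_u h B G \<tau> \<rho>\<^sub>0 p \<Phi> i x + ereal (\<phi>\<nu> i x) + ereal (1 / h * Lambda_G G \<tau> lam i x)
                + ereal (1 / h * Delta_step B \<phi>b i x y)
                + ereal (1 / h * Lambda_G G \<tau> lam (Suc i) y) + ereal (\<phi>\<nu> (Suc i) y)
                + psi_d NT h B G \<tau> p \<Phi> (Suc i) y)
              * ennreal (p i x y))"
      using distributed_pair[OF P_eq \<open>i < NT\<close>] by (simp only: density_pair)
  next
    show "markovian NT P"
      by (rule markovian_chain_weight[OF P_prob P_eq D])
  next
    fix k assume "k \<le> NT"
    then show "distributed P lborel (\<lambda>x. x k)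
              (\<lambda>x. exp_ereal
                (psi_u h B G \<tau> \<rho>\<^sub>0 p \<Phi> k x + ereal (\<phi>\<nu> k x) + ereal (1 / h * Lambda_G G \<tau> lam k x)
                 + psi_d NT h B G \<tau> p \<Phi> k x))"
      using distributed_coordinate[OF P_eq \<open>k \<le> NT\<close>] by (simp only: density_at)
  qed
qed

end
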